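(* Let a multi-armed bandit with $n$ arms, at most $k$ simultaneous pulls and horizon $T$ be given, let $\tilde\pi_0$ be any initial state distribution placing mass $1$ on a single state, and let $\bar\pi$ be an optimal solution of $RLP(\tilde\pi_0)$ as in the context (with $E[T_i]>0$ for all $i$ and $\sum_i E[T_i]=kT$). If the bandit satisfies the decreasing returns property, then the packing heuristic satisfies $$E\big[J^{\mu^{\rm packing}}(s,0)\,\big|\,s\sim\tilde\pi_0\big]\ \ge\ \tfrac18\,E\big[J^{*}(s,0)\,\big|\,s\sim\tilde\pi_0\big].$$
   Context: **Bandit model.** Integers $n\ge1$, $1\le k\le n$, $T\ge1$. Arm $i\in\{1,\dots,n\}$ is a Markov decision process with finite state space $\mathcal S_i$, finite action space $\mathcal A_i$, reward $r_i:\mathcal S_i\times\mathcal A_i\to\mathbb R_+$ (nonnegative reals) and transition kernel $P_i$, where $P_i(s_i,a_i,s_i')$ is the probability of moving from $s_i$ to $s_i'$ under action $a_i$. Each $\mathcal A_i$ contains an idle action $\phi_i$ with $r_i(s_i,\phi_i)=0$ and $P_i(s_i,\phi_i,s_i)=1$ for all $s_i$. Choosing an action $a_i\ne\phi_i$ is called a pull of arm $i$. Let $\mathcal S=\prod_i\mathcal S_i$, $\mathcal A=\prod_i\mathcal A_i$, $\mathcal A^{\rm feas}=\{a\in\mathcal A:\sum_i\mathbf 1_{a_i\ne\phi_i}\le k\}$, $r(s,a)=\sum_i r_i(s_i,a_i)$, $P(s,a,s')=\prod_iP_i(s_i,a_i,s_i')$. Times are $t\in\{0,\dots,T-1\}$.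 For a (possibly randomized) policy $\mu$, $J^\mu(s,0)$ is the expected total reward $E[\sum_{t=0}^{T-1}r(s^t,a^t)\mid s^0=s]$. $J^*(s,0)$ is the supremum of $J^\mu(s,0)$ over all randomized Markovian policies with values in $\mathcal A^{\rm feas}$ (this equals the supremum over all history-dependent randomized policies with values in $\mathcal A^{\rm feas}$). **Relaxed LP.** For a distribution $\tilde\pi_0$ on $\mathcal S$, $RLP(\tilde\pi_0)$ is the linear program in variables $\pi_i(s_i,a_i,t)\ge0$: maximize $\sum_i\sum_t\sum_{s_i,a_i}\pi_i(s_i,a_i,t)r_i(s_i,a_i)$ subject to (i) $\sum_{a_i}\pi_i(s_i,a_i,t)=\sum_{s_i',a_i'}P_i(s_i',a_i',s_i)\pi_i(s_i',a_i',t-1)$ for all $i$, $s_i$, $t>0$; (ii) $\sum_i\big[T-\sum_{s_i}\sum_t\pi_i(s_i,\phi_i,t)\big]\le kT$; (iii) $\sum_{a_i}\pi_i(s_i,a_i,0)=\sum_{\bar s:\bar s_i=s_i}\tilde\pi_0(\bar s)$ for all $i,s_i$. **Relaxed policy $\mu^R$.** $\tilde\pi_0$ puts mass $1$ on a single state $s_0=(s_{0,1},\dots,s_{0,n})$. Given an optimal solution $\bar\pi$ of $RLP(\tilde\pi_0)$, let the arms evolve independently of one another as follows: $s_i^0=s_{0,i}$; at time $t$ the action $\mu^R_i(s_i^t,t)$ equals $a_i$ with probability $\bar\pi_i(s_i^t,a_i,t)/\sum_{a}\bar\pi_i(s_i^t,a,t)$, independently of the past; then $s_i^{t+1}\sim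 P_i(s_i^t,\mu_i^R(s_i^t,t),\cdot)$. Define $R_i=\sum_{t=0}^{T-1}r_i(s_i^t,\mu_i^R(s_i^t,t))$ and $T_i=\sum_{t=0}^{T-1}\mathbf 1_{\mu_i^R(s_i^t,t)\ne\phi_i}$. It is assumed that $E[T_i]>0$ for all $i$ and $\sum_iE[T_i]=kT$. **Decreasing returns property.** Let $L_i(l)=\sum_{t=0}^l\mathbf 1_{\mu_i^R(s_i^t,t)\ne\phi_i}$ and $R_i^m=\sum_{l=0}^{T-1}\mathbf 1_{L_i(l)\le m}\,r_i(s_i^l,\mu_i^R(s_i^l,l))$ (reward from the first $m$ pulls). The property states: $E[R_i^{m+1}]-E[R_i^m]\le E[R_i^m]-E[R_i^{m-1}]$ for all $i$ and all integers $0<m<T$. **Packing heuristic $\mu^{\rm packing}$.** Renumber arms so that $E[R_1]/E[T_1]\ge E[R_2]/E[T_2]\ge\dots\ge E[R_n]/E[T_n]$. Initialize local times $l_i=0$, designated actions $a_i=\phi_i$, state $s\sim\tilde\pi_0$, active set $X=\{1,\dots,k\}$, available set $A=\{k+1,\dots,n\}$. For each $t=0,\dots,T-1$: (1) While there is $i\in X$ with $a_i=\phi_i$: pick such an $i$; while $a_i=\phi_i$ and $l_i<T$, draw $a_i$ with probability proportional to $\bar\pi_i(s_i,\cdot,l_i)$ and increase $l_i$ by $1$; afterwards, if $l_i=T$ and $a_i=\phi_i$, remove $i$ from $X$ permanently (discard it) and, if $A\ne\emptyset$, move $\min A$ from $A$ to $X$. (2) For every $i\in X$: pull arm $i$ with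 action $a_i$, earning $r_i(s_i,a_i)$ and updating $s_i$ to a draw from $P_i(s_i,a_i,\cdot)$; then reset $a_i=\phi_i$. Arms not in $X$ are idled. $J^{\mu^{\rm packing}}(s,0)$ is the expected total reward so earned over $t=0,\dots,T-1$ starting from state $s$. *)

theory Defs
  imports "HOL-Probability.Probability"
begin

section \<open>The bandit model\<close>

text \<open>
  Arms are the numbers below \<open>num_arms\<close>. The state and action spaces of different arms are
  subsets of common types; the transition probability from \<open>x\<close> to \<open>y\<close> under action \<open>a\<close> of
  arm \<open>i\<close> is \<open>pmf (kern B i x a) y\<close>.
\<close>

record ('s, 'a) bandit =
  num_arms :: nat
  max_pulls :: nat
  horizon :: nat
  states :: "nat \<Rightarrow> 's set"
  actions :: "nat \<Rightarrow> 'a set"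
  idle :: "nat \<Rightarrow> 'a"
  rew :: "nat \<Rightarrow> 's \<Rightarrow> 'a \<Rightarrow> real"
  kern :: "nat \<Rightarrow> 's \<Rightarrow> 'a \<Rightarrow> 's pmf"

definition is_bandit :: "('s, 'a) bandit \<Rightarrow> bool" where
  "is_bandit B \<longleftrightarrow>
     1 \<le> num_arms B \<and> 1 \<le> max_pulls B \<and> max_pulls B \<le> num_arms B \<and> 1 \<le> horizon B \<and>
     (\<forall>i<num_arms B.
        finite (states B i) \<and> finite (actions B i) \<and> idle B i \<in> actions B i \<and>
        (\<forall>x\<in>states B i. \<forall>a\<in>actions B i. 0 \<le> rew B i x a \<and> set_pmf (kern B i x a) \<subseteq> states B i) \<and>
        (\<forall>x\<in>states B i. rew B i x (idle B i) = 0 \<and> pmf (kern B i x (idle B i)) x = 1))"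

definition joint_states :: "('s, 'a) bandit \<Rightarrow> (nat \<Rightarrow> 's) set" where
  "joint_states B = PiE {..<num_arms B} (states B)"

definition joint_actions :: "('s, 'a) bandit \<Rightarrow> (nat \<Rightarrow> 'a) set" where
  "joint_actions B = PiE {..<num_arms B} (actions B)"

definition feas_actions :: "('s, 'a) bandit \<Rightarrow> (nat \<Rightarrow> 'a) set" where
  "feas_actions B = {a \<in> joint_actions B. card {i. i < num_arms B \<and> a i \<noteq> idle B i} \<le> max_pulls B}"

definition joint_rew :: "('s, 'a) bandit \<Rightarrow> (nat \<Rightarrow> 's) \<Rightarrow> (nat \<Rightarrow> 'a) \<Rightarrow> real" where
  "joint_rew B s a = (\<Sum>i<num_arms B. rew B i (s i) (a i))"

text \<open>The default value \<open>undefined\<close> of the product makes its outcomes elements of \<open>joint_states\<close>.\<close>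

definition joint_kern :: "('s, 'a) bandit \<Rightarrow> (nat \<Rightarrow> 's) \<Rightarrow> (nat \<Rightarrow> 'a) \<Rightarrow> (nat \<Rightarrow> 's) pmf" where
  "joint_kern B s a = Pi_pmf {..<num_arms B} undefined (\<lambda>i. kern B i (s i) (a i))"


section \<open>Randomized Markovian policies and the optimal value\<close>

definition feas_policy :: "('s, 'a) bandit \<Rightarrow> ((nat \<Rightarrow> 's) \<Rightarrow> nat \<Rightarrow> (nat \<Rightarrow> 'a) pmf) \<Rightarrow> bool" where
  "feas_policy B \<mu> \<longleftrightarrow> (\<forall>s\<in>joint_states B. \<forall>t<horizon B. set_pmf (\<mu> s t) \<subseteq> feas_actions B)"

text \<open>
  Law of the next \<open>m\<close> state-action pairs when the policy is followed from state \<open>s\<close> at time \<open>t\<close>.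
\<close>

primrec policy_traj :: "('s, 'a) bandit \<Rightarrow> ((nat \<Rightarrow> 's) \<Rightarrow> nat \<Rightarrow> (nat \<Rightarrow> 'a) pmf) \<Rightarrow>
    nat \<Rightarrow> nat \<Rightarrow> (nat \<Rightarrow> 's) \<Rightarrow> ((nat \<Rightarrow> 's) \<times> (nat \<Rightarrow> 'a)) list pmf" where
  "policy_traj B \<mu> 0 t s = return_pmf []"
| "policy_traj B \<mu> (Suc m) t s =
     bind_pmf (\<mu> s t) (\<lambda>a.
     bind_pmf (joint_kern B s a) (\<lambda>s'.
     map_pmf ((#) (s, a)) (policy_traj B \<mu> m (Suc t) s')))"

definition total_rew :: "('s, 'a) bandit \<Rightarrow> ((nat \<Rightarrow> 's) \<times> (nat \<Rightarrow> 'a)) list \<Rightarrow> real" where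
  "total_rew B h = (\<Sum>(s, a)\<leftarrow>h. joint_rew B s a)"

definition policy_value :: "('s, 'a) bandit \<Rightarrow> ((nat \<Rightarrow> 's) \<Rightarrow> nat \<Rightarrow> (nat \<Rightarrow> 'a) pmf) \<Rightarrow>
    (nat \<Rightarrow> 's) \<Rightarrow> real" where
  "policy_value B \<mu> s = measure_pmf.expectation (policy_traj B \<mu> (horizon B) 0 s) (total_rew B)"

definition opt_value :: "('s, 'a) bandit \<Rightarrow> (nat \<Rightarrow> 's) \<Rightarrow> real" where
  "opt_value B s = (SUP \<mu>\<in>{\<mu>. feas_policy B \<mu>}. policy_value B \<mu> s)"


section \<open>The relaxed linear program\<close>

definition rlp_feasible :: "('s, 'a) bandit \<Rightarrow> (nat \<Rightarrow> 's) pmf \<Rightarrow>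
    (nat \<Rightarrow> 's \<Rightarrow> 'a \<Rightarrow> nat \<Rightarrow> real) \<Rightarrow> bool" where
  "rlp_feasible B \<pi>0 \<pi> \<longleftrightarrow>
     (\<forall>i<num_arms B. \<forall>x\<in>states B i. \<forall>a\<in>actions B i. \<forall>t<horizon B. 0 \<le> \<pi> i x a t) \<and>
     (\<forall>i<num_arms B. \<forall>x\<in>states B i. \<forall>t<horizon B. 0 < t \<longrightarrow>
        (\<Sum>a\<in>actions B i. \<pi> i x a t) =
        (\<Sum>x'\<in>states B i. \<Sum>a'\<in>actions B i. pmf (kern B i x' a') x * \<pi> i x' a' (t - 1))) \<and>
     (\<Sum>i<num_arms B. real (horizon B) - (\<Sum>x\<in>states B i. \<Sum>t<horizon B. \<pi> i x (idle B i) t))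
        \<le> real (max_pulls B) * real (horizon B) \<and>
     (\<forall>i<num_arms B. \<forall>x\<in>states B i.
        (\<Sum>a\<in>actions B i. \<pi> i x a 0) = (\<Sum>s\<in>{s \<in> joint_states B. s i = x}. pmf \<pi>0 s))"

definition rlp_objective :: "('s, 'a) bandit \<Rightarrow> (nat \<Rightarrow> 's \<Rightarrow> 'a \<Rightarrow> nat \<Rightarrow> real) \<Rightarrow> real" where
  "rlp_objective B \<pi> =
     (\<Sum>i<num_arms B. \<Sum>t<horizon B. \<Sum>x\<in>states B i. \<Sum>a\<in>actions B i. \<pi> i x a t * rew B i x a)"

definition rlp_optimal :: "('s, 'a) bandit \<Rightarrow> (nat \<Rightarrow> 's) pmf \<Rightarrow>
    (nat \<Rightarrow> 's \<Rightarrow> 'a \<Rightarrow> nat \<Rightarrow> real) \<Rightarrow> bool" where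
  "rlp_optimal B \<pi>0 \<pi> \<longleftrightarrow> rlp_feasible B \<pi>0 \<pi> \<and>
     (\<forall>\<pi>'. rlp_feasible B \<pi>0 \<pi>' \<longrightarrow> rlp_objective B \<pi>' \<le> rlp_objective B \<pi>)"


section \<open>The relaxed policy\<close>

text \<open>
  The action drawn for arm \<open>i\<close> in state \<open>x\<close> at (local) time \<open>t\<close>. Where all weights vanish the
  proportional draw is meaningless; idling is chosen there. For a feasible solution of the linear
  program this happens only in states that the arm reaches at time \<open>t\<close> with probability zero.
\<close>

definition relaxed_action :: "('s, 'a) bandit \<Rightarrow> (nat \<Rightarrow> 's \<Rightarrow> 'a \<Rightarrow> nat \<Rightarrow> real) \<Rightarrow>
    nat \<Rightarrow> 's \<Rightarrow> nat \<Rightarrow> 'a pmf" where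
  "relaxed_action B \<pi> i x t =
     (let w = (\<Sum>a\<in>actions B i. \<pi> i x a t)
      in if w = 0 then return_pmf (idle B i)
         else embed_pmf (\<lambda>a. if a \<in> actions B i then \<pi> i x a t / w else 0))"

text \<open>Law of the next \<open>m\<close> state-action pairs of arm \<open>i\<close>, from state \<open>x\<close> at time \<open>t\<close>.\<close>

primrec relaxed_arm_traj :: "('s, 'a) bandit \<Rightarrow> (nat \<Rightarrow> 's \<Rightarrow> 'a \<Rightarrow> nat \<Rightarrow> real) \<Rightarrow>
    nat \<Rightarrow> nat \<Rightarrow> nat \<Rightarrow> 's \<Rightarrow> ('s \<times> 'a) list pmf" where
  "relaxed_arm_traj B \<pi> i 0 t x = return_pmf []"
| "relaxed_arm_traj B \<pi> i (Suc m) t x =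
     bind_pmf (relaxed_action B \<pi> i x t) (\<lambda>a.
     bind_pmf (kern B i x a) (\<lambda>y.
     map_pmf ((#) (x, a)) (relaxed_arm_traj B \<pi> i m (Suc t) y)))"

definition relaxed_traj :: "('s, 'a) bandit \<Rightarrow> (nat \<Rightarrow> 's \<Rightarrow> 'a \<Rightarrow> nat \<Rightarrow> real) \<Rightarrow>
    (nat \<Rightarrow> 's) \<Rightarrow> (nat \<Rightarrow> ('s \<times> 'a) list) pmf" where
  "relaxed_traj B \<pi> s0 =
     Pi_pmf {..<num_arms B} [] (\<lambda>i. relaxed_arm_traj B \<pi> i (horizon B) 0 (s0 i))"

text \<open>The quantities \<open>R\<^sub>i\<close>, \<open>T\<^sub>i\<close>, \<open>L\<^sub>i(l)\<close> and \<open>R\<^sub>i\<^sup>m\<close> of a trajectory \<open>h\<close> of arm \<open>i\<close>.\<close>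

definition arm_rew :: "('s, 'a) bandit \<Rightarrow> nat \<Rightarrow> ('s \<times> 'a) list \<Rightarrow> real" where
  "arm_rew B i h = (\<Sum>t<horizon B. rew B i (fst (h ! t)) (snd (h ! t)))"

definition arm_pulls :: "('s, 'a) bandit \<Rightarrow> nat \<Rightarrow> ('s \<times> 'a) list \<Rightarrow> nat" where
  "arm_pulls B i h = (\<Sum>t<horizon B. of_bool (snd (h ! t) \<noteq> idle B i))"

definition pulls_upto :: "('s, 'a) bandit \<Rightarrow> nat \<Rightarrow> ('s \<times> 'a) list \<Rightarrow> nat \<Rightarrow> nat" where
  "pulls_upto B i h l = (\<Sum>t\<le>l. of_bool (snd (h ! t) \<noteq> idle B i))"

definition arm_rew_first :: "('s, 'a) bandit \<Rightarrow> nat \<Rightarrow> nat \<Rightarrow> ('s \<times> 'a) list \<Rightarrow> real" where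
  "arm_rew_first B i m h =
     (\<Sum>l<horizon B. of_bool (pulls_upto B i h l \<le> m) * rew B i (fst (h ! l)) (snd (h ! l)))"

definition exp_rew :: "('s, 'a) bandit \<Rightarrow> (nat \<Rightarrow> 's \<Rightarrow> 'a \<Rightarrow> nat \<Rightarrow> real) \<Rightarrow>
    (nat \<Rightarrow> 's) \<Rightarrow> nat \<Rightarrow> real" where
  "exp_rew B \<pi> s0 i = measure_pmf.expectation (relaxed_traj B \<pi> s0) (\<lambda>h. arm_rew B i (h i))"

definition exp_pulls :: "('s, 'a) bandit \<Rightarrow> (nat \<Rightarrow> 's \<Rightarrow> 'a \<Rightarrow> nat \<Rightarrow> real) \<Rightarrow>
    (nat \<Rightarrow> 's) \<Rightarrow> nat \<Rightarrow> real" where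
  "exp_pulls B \<pi> s0 i =
     measure_pmf.expectation (relaxed_traj B \<pi> s0) (\<lambda>h. real (arm_pulls B i (h i)))"

definition exp_rew_first :: "('s, 'a) bandit \<Rightarrow> (nat \<Rightarrow> 's \<Rightarrow> 'a \<Rightarrow> nat \<Rightarrow> real) \<Rightarrow>
    (nat \<Rightarrow> 's) \<Rightarrow> nat \<Rightarrow> nat \<Rightarrow> real" where
  "exp_rew_first B \<pi> s0 i m =
     measure_pmf.expectation (relaxed_traj B \<pi> s0) (\<lambda>h. arm_rew_first B i m (h i))"

definition decreasing_returns :: "('s, 'a) bandit \<Rightarrow> (nat \<Rightarrow> 's \<Rightarrow> 'a \<Rightarrow> nat \<Rightarrow> real) \<Rightarrow>
    (nat \<Rightarrow> 's) \<Rightarrow> bool" where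
  "decreasing_returns B \<pi> s0 \<longleftrightarrow>
     (\<forall>i<num_arms B. \<forall>m. 0 < m \<and> m < horizon B \<longrightarrow>
        exp_rew_first B \<pi> s0 i (m + 1) - exp_rew_first B \<pi> s0 i m
        \<le> exp_rew_first B \<pi> s0 i m - exp_rew_first B \<pi> s0 i (m - 1))"


section \<open>The packing heuristic\<close>

text \<open>
  The renumbering of the arms is a list \<open>ord\<close> of all arms by nonincreasing ratio of expected
  reward to expected number of pulls, ties being broken arbitrarily. The set of available arms is
  kept as a suffix of \<open>ord\<close>, so that its head is the available arm ranked first.
\<close>

definition ratio_order :: "('s, 'a) bandit \<Rightarrow> (nat \<Rightarrow> 's \<Rightarrow> 'a \<Rightarrow> nat \<Rightarrow> real) \<Rightarrow>
    (nat \<Rightarrow> 's) \<Rightarrow> nat list \<Rightarrow> bool" where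
  "ratio_order B \<pi> s0 ord \<longleftrightarrow>
     distinct ord \<and> set ord = {..<num_arms B} \<and>
     sorted_wrt (\<lambda>i j. exp_rew B \<pi> s0 i / exp_pulls B \<pi> s0 i \<ge> exp_rew B \<pi> s0 j / exp_pulls B \<pi> s0 j) ord"

record ('s, 'a) pack_conf =
  local_time :: "nat \<Rightarrow> nat"
  designated :: "nat \<Rightarrow> 'a"
  cur_state :: "nat \<Rightarrow> 's"
  active :: "nat set"
  avail :: "nat list"

definition init_conf :: "('s, 'a) bandit \<Rightarrow> nat list \<Rightarrow> (nat \<Rightarrow> 's) \<Rightarrow> ('s, 'a) pack_conf" where
  "init_conf B ord s =
     \<lparr>local_time = (\<lambda>_. 0), designated = idle B, cur_state = s,
      active = set (take (max_pulls B) ord), avail = drop (max_pulls B) ord\<rparr>"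

text \<open>
  The inner loop for arm \<open>i\<close> in state \<open>x\<close> at local time \<open>l\<close> with the idle action designated:
  the result is the designated action and the local time on exit.
\<close>

function draw_action :: "('s, 'a) bandit \<Rightarrow> (nat \<Rightarrow> 's \<Rightarrow> 'a \<Rightarrow> nat \<Rightarrow> real) \<Rightarrow>
    nat \<Rightarrow> 's \<Rightarrow> nat \<Rightarrow> ('a \<times> nat) pmf" where
  "draw_action B \<pi> i x l =
     (if l < horizon B then
        bind_pmf (relaxed_action B \<pi> i x l) (\<lambda>a.
          if a = idle B i then draw_action B \<pi> i x (Suc l) else return_pmf (a, Suc l))
      else return_pmf (idle B i, l))"
  by pat_completeness auto
termination
  by (relation "Wellfounded.measure (\<lambda>(B, \<pi>, i, x, l). horizon B - l)") auto

declare draw_action.simps [simp del]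

definition pending :: "('s, 'a) bandit \<Rightarrow> ('s, 'a) pack_conf \<Rightarrow> nat set" where
  "pending B c = {i. i < num_arms B \<and> i \<in> active c \<and> designated c i = idle B i}"

definition discard :: "nat \<Rightarrow> ('s, 'a) pack_conf \<Rightarrow> ('s, 'a) pack_conf" where
  "discard i c =
     (case avail c of
        [] \<Rightarrow> c\<lparr>active := active c - {i}\<rparr>
      | j # js \<Rightarrow> c\<lparr>active := insert j (active c - {i}), avail := js\<rparr>)"

definition update_arm :: "('s, 'a) bandit \<Rightarrow> nat \<Rightarrow> 'a \<Rightarrow> nat \<Rightarrow> ('s, 'a) pack_conf \<Rightarrow>
    ('s, 'a) pack_conf" where
  "update_arm B i a l c =
     (let c' = c\<lparr>local_time := (local_time c)(i := l), designated := (designated c)(i := a)\<rparr>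
      in if horizon B \<le> l \<and> a = idle B i then discard i c' else c')"

text \<open>
  The order in which step (1) treats the pending arms is left open by the heuristic; \<open>pick\<close> is any
  rule choosing a pending arm as long as there is one.
\<close>

definition pick_rule :: "('s, 'a) bandit \<Rightarrow> (('s, 'a) pack_conf \<Rightarrow> nat) \<Rightarrow> bool" where
  "pick_rule B pick \<longleftrightarrow> (\<forall>c. pending B c \<noteq> {} \<longrightarrow> pick c \<in> pending B c)"

lemma draw_action_exit:
  "(a, l') \<in> set_pmf (draw_action B \<pi> i x l) \<Longrightarrow> a \<noteq> idle B i \<or> horizon B \<le> l'"
proof (induction B \<pi> i x l rule: draw_action.induct)
  case (1 B \<pi> i x l)
  then show ?case
    by (subst (asm) draw_action.simps[of B \<pi> i x l]) (auto split: if_splits)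
qed

lemma finite_pending [simp]: "finite (pending B c)"
  by (rule finite_subset[of _ "{..<num_arms B}"]) (auto simp: pending_def)

lemma pending_update_arm:
  assumes "i \<in> pending B c" "a \<noteq> idle B i \<or> horizon B \<le> l"
  shows "card (pending B (update_arm B i a l c)) + length (avail (update_arm B i a l c))
         < card (pending B c) + length (avail c)"
proof -
  have pos: "Suc (card (pending B c - {i})) = card (pending B c)"
    using assms(1) by (intro card_Suc_Diff1) simp_all
  show ?thesis
  proof (cases "horizon B \<le> l \<and> a = idle B i")
    case False
    with assms(2) have a: "a \<noteq> idle B i" by auto
    have "pending B (update_arm B i a l c) \<subseteq> pending B c - {i}"
      using False a by (auto simp: pending_def update_arm_def Let_def)
    then have "card (pending B (update_arm B i a l c)) \<le> card (pending B c - {i})"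
      by (intro card_mono) auto
    with False pos show ?thesis by (auto simp: update_arm_def Let_def)
  next
    case True
    show ?thesis
    proof (cases "avail c")
      case Nil
      have "pending B (update_arm B i a l c) \<subseteq> pending B c - {i}"
        using True Nil by (auto simp: pending_def update_arm_def Let_def discard_def)
      then have "card (pending B (update_arm B i a l c)) \<le> card (pending B c - {i})"
        by (intro card_mono) auto
      with True Nil pos show ?thesis by (auto simp: update_arm_def Let_def discard_def)
    next
      case (Cons j js)
      have "pending B (update_arm B i a l c) \<subseteq> insert j (pending B c - {i})"
        using True Cons by (auto simp: pending_def update_arm_def Let_def discard_def)
      then have "card (pending B (update_arm B i a l c)) \<le> card (insert j (pending B c - {i}))"
        by (intro card_mono) auto
      also have "\<dots> \<le> Suc (card (pending B c - {i}))"
        by (rule card_insert_le_m1) auto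
      finally show ?thesis
        using True Cons pos by (auto simp: update_arm_def Let_def discard_def)
    qed
  qed
qed

text \<open>
  Step (1). For a \<open>pick_rule\<close> the loop condition says that some arm is pending; the form used here
  makes the loop terminate for every function \<open>pick\<close>.
\<close>

function designate :: "('s, 'a) bandit \<Rightarrow> (nat \<Rightarrow> 's \<Rightarrow> 'a \<Rightarrow> nat \<Rightarrow> real) \<Rightarrow>
    (('s, 'a) pack_conf \<Rightarrow> nat) \<Rightarrow> ('s, 'a) pack_conf \<Rightarrow> ('s, 'a) pack_conf pmf" where
  "designate B \<pi> pick c =
     (let i = pick c
      in if i \<in> pending B c then
           bind_pmf (draw_action B \<pi> i (cur_state c i) (local_time c i)) (\<lambda>d.
             designate B \<pi> pick (update_arm B i (fst d) (snd d) c))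
         else return_pmf c)"
  by pat_completeness auto
termination
proof (relation "Wellfounded.measure (\<lambda>(B, \<pi>, pick, c). card (pending B c) + length (avail c))", goal_cases)
  case 1
  show ?case by simp
next
  case (2 B \<pi> pick c i d)
  then have "fst d \<noteq> idle B i \<or> horizon B \<le> snd d"
    by (metis draw_action_exit prod.collapse)
  with 2 show ?case by (simp add: pending_update_arm)
qed

declare designate.simps [simp del]

definition pack_action :: "('s, 'a) bandit \<Rightarrow> ('s, 'a) pack_conf \<Rightarrow> nat \<Rightarrow> 'a" where
  "pack_action B c = (\<lambda>i\<in>{..<num_arms B}. if i \<in> active c then designated c i else idle B i)"

text \<open>Law of the state-action pairs of the heuristic over \<open>m\<close> periods, from configuration \<open>c\<close>.\<close>

primrec pack_traj :: "('s, 'a) bandit \<Rightarrow> (nat \<Rightarrow> 's \<Rightarrow> 'a \<Rightarrow> nat \<Rightarrow> real) \<Rightarrow>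
    (('s, 'a) pack_conf \<Rightarrow> nat) \<Rightarrow> nat \<Rightarrow> ('s, 'a) pack_conf \<Rightarrow>
    ((nat \<Rightarrow> 's) \<times> (nat \<Rightarrow> 'a)) list pmf" where
  "pack_traj B \<pi> pick 0 c = return_pmf []"
| "pack_traj B \<pi> pick (Suc m) c =
     bind_pmf (designate B \<pi> pick c) (\<lambda>c'.
     bind_pmf (joint_kern B (cur_state c') (pack_action B c')) (\<lambda>s'.
     map_pmf ((#) (cur_state c', pack_action B c'))
       (pack_traj B \<pi> pick m
          (c'\<lparr>cur_state := s',
              designated := (\<lambda>i. if i \<in> active c' then idle B i else designated c' i)\<rparr>))))"

definition pack_value :: "('s, 'a) bandit \<Rightarrow> (nat \<Rightarrow> 's \<Rightarrow> 'a \<Rightarrow> nat \<Rightarrow> real) \<Rightarrow>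
    nat list \<Rightarrow> (('s, 'a) pack_conf \<Rightarrow> nat) \<Rightarrow> (nat \<Rightarrow> 's) \<Rightarrow> real" where
  "pack_value B \<pi> ord pick s =
     measure_pmf.expectation (pack_traj B \<pi> pick (horizon B) (init_conf B ord s)) (total_rew B)"

end

theory Submission
  imports Defs
begin

text \<open>
  The heuristic is compared with the value $\sum_i E[R_i]$ of the linear program, which bounds the
  optimum because the state-action frequencies of every feasible policy form a feasible solution
  of the program (\<open>opt_value_le_objective\<close>), while the relaxed policy reproduces the
  frequencies \<open>\<pi>\<close> and hence the value of \<open>\<pi>\<close> (\<open>sum_exp_rew_eq_objective\<close>).

  The idea for the lower bound on the heuristic is the following. Within its own local time an arm
  that is being packed behaves exactly as under the relaxed policy; the time during which it idles
  there is merely skipped. As long as arms are waiting, all \<open>k\<close> slots are busy, so an arm starts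
  at time at most $X/k$, where \<open>X\<close> is the number of pulls of the arms ranked before it. It can then
  make at least $T - X/k$ pulls, and by decreasing returns the first \<open>m\<close> pulls earn in expectation
  at least the fraction $m/T$ of $E[R_i]$. The resulting bound $(1 - X/(kT)) E[R_i]$ is affine
  in \<open>X\<close>, so that only expectations of \<open>X\<close> are needed.

  Because of this linearity no coupling of the heuristic with independent arm trajectories is
  necessary. The bound is turned into a potential, a function of a configuration and of the number
  of remaining periods: each active arm contributes the expected reward of the pulls that it can
  still make, and each waiting arm contributes $(m - L/k) E[R_i] / T$, where \<open>L\<close> is the expected
  number of pulls still to be made by the active arms and by the arms waiting in front of it. A
  period of pulls keeps the potential plus the collected reward constant in expectation
  (\<open>potential_pull\<close>), and designating actions does not decrease it in expectation
  (\<open>potential_draw\<close>). Hence the heuristic earns at least the initial potential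
  (\<open>potential_le_pack_traj\<close>).

  That potential is at least $\sum_i E[R_i] (1 - S_i/(kT))$, where $S_i$ is the sum of
  $E[T_j]$ over the arms \<open>j\<close> ranked before \<open>i\<close>. Since $\sum_j E[T_j] = kT$, the factor
  of $E[R_i]$ is the share of pulls of the arms from \<open>i\<close> on. Pairing the terms $(i, j)$
  and $(j, i)$ and using the order of the ratios shows that the sum is at least half of
  $\sum_i E[R_i]$ (\<open>queue_gain_ratio_order\<close>). The argument therefore yields the factor
  $1/2$, of which the claimed $1/8$ is a consequence.
\<close>

section \<open>Expectations over finitely supported distributions\<close>

abbreviation expect :: "'a pmf \<Rightarrow> ('a \<Rightarrow> real) \<Rightarrow> real" where
  "expect p f \<equiv> measure_pmf.expectation p f"

lemma expect_bind:
  assumes "finite (set_pmf p)" "\<And>x. x \<in> set_pmf p \<Longrightarrow> finite (set_pmf (f x))"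
  shows "expect (bind_pmf p f) g = expect p (\<lambda>x. expect (f x) g)"
proof -
  have "expect (bind_pmf p f) g = (\<Sum>x\<in>set_pmf p. pmf p x *\<^sub>R expect (f x) g)"
    using assms by (intro pmf_expectation_bind) auto
  also have "\<dots> = expect p (\<lambda>x. expect (f x) g)"
    using assms by (intro integral_measure_pmf[symmetric]) auto
  finally show ?thesis .
qed

lemma expect_cong:
  assumes "\<And>x. x \<in> set_pmf p \<Longrightarrow> f x = g x"
  shows "expect p f = expect p g"
  using assms by (intro integral_cong_AE) (auto simp: AE_measure_pmf_iff)

lemma expect_mono:
  assumes "finite (set_pmf p)" "\<And>x. x \<in> set_pmf p \<Longrightarrow> f x \<le> g x"
  shows "expect p f \<le> expect p g"
  using assms by (intro integral_mono_AE) (auto simp: AE_measure_pmf_iff integrable_measure_pmf_finite)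

lemma expect_add:
  assumes "finite (set_pmf p)"
  shows "expect p (\<lambda>x. f x + g x) = expect p f + expect p g"
  using assms by (intro Bochner_Integration.integral_add) (auto simp: integrable_measure_pmf_finite)

lemma expect_sum:
  assumes "finite (set_pmf p)"
  shows "expect p (\<lambda>x. \<Sum>i\<in>I. f i x) = (\<Sum>i\<in>I. expect p (f i))"
  using assms by (intro Bochner_Integration.integral_sum) (auto simp: integrable_measure_pmf_finite)

lemma expect_nonneg:
  assumes "\<And>x. x \<in> set_pmf p \<Longrightarrow> 0 \<le> f x"
  shows "0 \<le> expect p f"
  using assms by (intro integral_nonneg_AE) (auto simp: AE_measure_pmf_iff)

lemma expect_Pi_pmf_component:
  assumes "finite I" "i \<in> I"
  shows "expect (Pi_pmf I d p) (\<lambda>f. g (f i)) = expect (p i) g"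
proof -
  have "expect (p i) g = expect (map_pmf (\<lambda>f. f i) (Pi_pmf I d p)) g"
    using assms by (simp add: Pi_pmf_component)
  then show ?thesis by simp
qed

lemma pmf_eq_1_imp_return:
  assumes "pmf p x = 1"
  shows "p = return_pmf x"
proof -
  have "AE y in measure_pmf p. y \<in> {x}"
    using assms by (subst measure_pmf.prob_eq_1[symmetric]) (auto simp: measure_pmf_single)
  then have "set_pmf p \<subseteq> {x}" by (auto simp: AE_measure_pmf_iff)
  then show ?thesis by (simp add: set_pmf_subset_singleton)
qed

section \<open>The linear program bounds the optimal value\<close>

locale bandit_model =
  fixes B :: "('s, 'a) bandit"
  assumes is_bandit: "is_bandit B"
begin

lemma
  shows max_pulls_pos: "1 \<le> max_pulls B"
    and max_pulls_le: "max_pulls B \<le> num_arms B"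
    and horizon_pos: "1 \<le> horizon B"
  using is_bandit by (auto simp: is_bandit_def)

context
  fixes i
  assumes i: "i < num_arms B"
begin

lemma
  shows finite_states: "finite (states B i)"
    and finite_actions: "finite (actions B i)"
    and idle_action: "idle B i \<in> actions B i"
  using is_bandit i by (auto simp: is_bandit_def)

lemma rew_nonneg: "x \<in> states B i \<Longrightarrow> a \<in> actions B i \<Longrightarrow> 0 \<le> rew B i x a"
  using is_bandit i by (auto simp: is_bandit_def)

lemma set_kern: "x \<in> states B i \<Longrightarrow> a \<in> actions B i \<Longrightarrow> set_pmf (kern B i x a) \<subseteq> states B i"
  using is_bandit i by (auto simp: is_bandit_def)

lemma finite_set_kern: "x \<in> states B i \<Longrightarrow> a \<in> actions B i \<Longrightarrow> finite (set_pmf (kern B i x a))"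
  using set_kern finite_states finite_subset by metis

lemma rew_idle: "x \<in> states B i \<Longrightarrow> rew B i x (idle B i) = 0"
  using is_bandit i by (auto simp: is_bandit_def)

lemma kern_idle: "x \<in> states B i \<Longrightarrow> kern B i x (idle B i) = return_pmf x"
  using is_bandit i by (intro pmf_eq_1_imp_return) (auto simp: is_bandit_def)

end

lemma finite_joint_states: "finite (joint_states B)"
  unfolding joint_states_def by (intro finite_PiE) (auto simp: finite_states)

lemma finite_joint_actions: "finite (joint_actions B)"
  unfolding joint_actions_def by (intro finite_PiE) (auto simp: finite_actions)

lemma finite_feas_actions: "finite (feas_actions B)"
  using finite_joint_actions by (rule rev_finite_subset) (auto simp: feas_actions_def)

lemma feas_action_component: "a \<in> feas_actions B \<Longrightarrow> i < num_arms B \<Longrightarrow> a i \<in> actions B i"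
  by (auto simp: feas_actions_def joint_actions_def)

lemma joint_state_component: "s \<in> joint_states B \<Longrightarrow> i < num_arms B \<Longrightarrow> s i \<in> states B i"
  by (auto simp: joint_states_def)

lemma sum_return_pmf_component:
  assumes "s0 \<in> joint_states B"
  shows "(\<Sum>s\<in>{s \<in> joint_states B. s i = x}. pmf (return_pmf s0) s) = pmf (return_pmf (s0 i)) x"
  using assms finite_joint_states by (auto simp: pmf_return indicator_def sum.delta)

lemma set_joint_kern:
  assumes "\<And>i. i < num_arms B \<Longrightarrow> s i \<in> states B i" "\<And>i. i < num_arms B \<Longrightarrow> a i \<in> actions B i"
  shows "set_pmf (joint_kern B s a) \<subseteq> joint_states B"
proof -
  have "PiE_dflt {..<num_arms B} undefined (set_pmf \<circ> (\<lambda>i. kern B i (s i) (a i))) \<subseteq> joint_states B"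
    using assms set_kern by (fastforce simp: PiE_dflt_def joint_states_def)
  then show ?thesis by (simp add: joint_kern_def set_Pi_pmf)
qed

lemma finite_set_joint_kern:
  assumes "\<And>i. i < num_arms B \<Longrightarrow> s i \<in> states B i" "\<And>i. i < num_arms B \<Longrightarrow> a i \<in> actions B i"
  shows "finite (set_pmf (joint_kern B s a))"
  using set_joint_kern[OF assms] finite_joint_states by (rule finite_subset)

end

locale feasible_policy = bandit_model B for B :: "('s, 'a) bandit" +
  fixes \<mu> :: "(nat \<Rightarrow> 's) \<Rightarrow> nat \<Rightarrow> (nat \<Rightarrow> 'a) pmf" and s0 :: "nat \<Rightarrow> 's"
  assumes feas: "feas_policy B \<mu>" and s0: "s0 \<in> joint_states B"
begin

lemma set_policy: "s \<in> joint_states B \<Longrightarrow> t < horizon B \<Longrightarrow> set_pmf (\<mu> s t) \<subseteq> feas_actions B"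
  using feas by (auto simp: feas_policy_def)

lemma finite_set_policy: "s \<in> joint_states B \<Longrightarrow> t < horizon B \<Longrightarrow> finite (set_pmf (\<mu> s t))"
  using set_policy finite_feas_actions finite_subset by metis

primrec state_law :: "nat \<Rightarrow> (nat \<Rightarrow> 's) pmf" where
  "state_law 0 = return_pmf s0"
| "state_law (Suc t) = bind_pmf (state_law t) (\<lambda>s. bind_pmf (\<mu> s t) (joint_kern B s))"

definition state_action_law :: "nat \<Rightarrow> ((nat \<Rightarrow> 's) \<times> (nat \<Rightarrow> 'a)) pmf" where
  "state_action_law t = bind_pmf (state_law t) (\<lambda>s. map_pmf (Pair s) (\<mu> s t))"

lemma set_joint_kern_policy:
  assumes "s \<in> joint_states B" "t < horizon B" "a \<in> set_pmf (\<mu> s t)"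
  shows "set_pmf (joint_kern B s a) \<subseteq> joint_states B"
  using assms set_policy feas_action_component joint_state_component
  by (intro set_joint_kern) blast+

lemma set_state_law: "t \<le> horizon B \<Longrightarrow> set_pmf (state_law t) \<subseteq> joint_states B"
proof (induction t)
  case 0
  then show ?case using s0 by simp
next
  case (Suc t)
  then show ?case using set_joint_kern_policy[of _ t] by fastforce
qed

lemma finite_set_state_law: "t \<le> horizon B \<Longrightarrow> finite (set_pmf (state_law t))"
  using set_state_law finite_joint_states finite_subset by metis

lemma set_state_action_law:
  "t < horizon B \<Longrightarrow> set_pmf (state_action_law t) \<subseteq> joint_states B \<times> feas_actions B"
  using set_state_law[of t] set_policy by (fastforce simp: state_action_law_def)

lemma finite_set_state_action_law: "t < horizon B \<Longrightarrow> finite (set_pmf (state_action_law t))"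
  using set_state_action_law finite_joint_states finite_feas_actions
  by (meson finite_SigmaI finite_subset)

lemma finite_set_policy_traj:
  "s \<in> joint_states B \<Longrightarrow> t + m \<le> horizon B \<Longrightarrow> finite (set_pmf (policy_traj B \<mu> m t s))"
proof (induction m arbitrary: t s)
  case (Suc m)
  have "finite (set_pmf (joint_kern B s a))" if "a \<in> set_pmf (\<mu> s t)" for a
    using set_joint_kern_policy[of s t a] Suc.prems that finite_joint_states finite_subset by auto
  moreover have "finite (set_pmf (policy_traj B \<mu> m (Suc t) s'))"
    if "a \<in> set_pmf (\<mu> s t)" "s' \<in> set_pmf (joint_kern B s a)" for a s'
    using set_joint_kern_policy[of s t a] Suc.prems that by (intro Suc.IH) auto
  ultimately show ?case
    using Suc.prems by (auto simp: finite_set_policy)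
qed simp

text \<open>
  By induction on the number of remaining periods: the first period contributes the expected reward
  at time \<open>t\<close>, and averaging over its outcome turns the state law at \<open>t\<close> into the one at \<open>t + 1\<close>.
\<close>

lemma expect_total_rew:
  "t + m \<le> horizon B \<Longrightarrow>
     expect (state_law t) (\<lambda>s. expect (policy_traj B \<mu> m t s) (total_rew B))
     = (\<Sum>j<m. expect (state_action_law (t + j)) (\<lambda>(s, a). joint_rew B s a))"
proof (induction m arbitrary: t)
  case 0
  then show ?case by (simp add: total_rew_def)
next
  case (Suc m)
  let ?f = "\<lambda>s. expect (policy_traj B \<mu> m (Suc t) s) (total_rew B)"
  have t: "t < horizon B" "t \<le> horizon B" using Suc.prems by auto
  have fk: "finite (set_pmf (joint_kern B s a))" if "s \<in> joint_states B" "a \<in> set_pmf (\<mu> s t)" for s a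
    using set_joint_kern_policy[of s t a] t that finite_joint_states finite_subset by auto
  have step: "expect (policy_traj B \<mu> (Suc m) t s) (total_rew B)
      = expect (\<mu> s t) (joint_rew B s) + expect (bind_pmf (\<mu> s t) (joint_kern B s)) ?f"
    if s: "s \<in> joint_states B" for s
  proof -
    have ft: "finite (set_pmf (policy_traj B \<mu> m (Suc t) s'))"
      if "a \<in> set_pmf (\<mu> s t)" "s' \<in> set_pmf (joint_kern B s a)" for a s'
      using set_joint_kern_policy[of s t a] Suc.prems that s by (intro finite_set_policy_traj) auto
    have "expect (policy_traj B \<mu> (Suc m) t s) (total_rew B)
        = expect (\<mu> s t) (\<lambda>a. expect (joint_kern B s a) (\<lambda>s'.
            expect (policy_traj B \<mu> m (Suc t) s') (\<lambda>h. joint_rew B s a + total_rew B h)))"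
      using s t fk ft
      by (auto simp: expect_bind finite_set_policy total_rew_def intro!: expect_cong)
    also have "\<dots> = expect (\<mu> s t) (\<lambda>a. joint_rew B s a + expect (joint_kern B s a) ?f)"
      using s t fk ft by (intro expect_cong) (auto simp: expect_add cong: expect_cong)
    also have "\<dots> = expect (\<mu> s t) (joint_rew B s) + expect (bind_pmf (\<mu> s t) (joint_kern B s)) ?f"
      using s t fk by (simp add: expect_add expect_bind finite_set_policy)
    finally show ?thesis .
  qed
  have "expect (state_law t) (\<lambda>s. expect (policy_traj B \<mu> (Suc m) t s) (total_rew B))
      = expect (state_law t) (\<lambda>s. expect (\<mu> s t) (joint_rew B s)
          + expect (bind_pmf (\<mu> s t) (joint_kern B s)) ?f)"
    using t set_state_law[of t] step by (intro expect_cong) auto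
  also have "\<dots> = expect (state_law t) (\<lambda>s. expect (\<mu> s t) (joint_rew B s))
      + expect (state_law t) (\<lambda>s. expect (bind_pmf (\<mu> s t) (joint_kern B s)) ?f)"
    using t by (intro expect_add finite_set_state_law)
  also have "expect (state_law t) (\<lambda>s. expect (\<mu> s t) (joint_rew B s))
      = expect (state_action_law t) (\<lambda>(s, a). joint_rew B s a)"
    using t set_state_law[of t] finite_set_policy[of _ t]
    by (subst state_action_law_def, subst expect_bind) (auto simp: finite_set_state_law)
  also have "expect (state_law t) (\<lambda>s. expect (bind_pmf (\<mu> s t) (joint_kern B s)) ?f)
      = expect (state_law (Suc t)) ?f"
    using t set_state_law[of t] finite_set_policy[of _ t] fk
    by (simp, subst expect_bind) (auto simp: finite_set_state_law)
  also have "\<dots> = (\<Sum>j<m. expect (state_action_law (Suc t + j)) (\<lambda>(s, a). joint_rew B s a))"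
    using Suc.prems by (intro Suc.IH) auto
  finally show ?case
    by (simp add: sum.lessThan_Suc_shift del: sum.lessThan_Suc)
qed

definition occupation :: "nat \<Rightarrow> 's \<Rightarrow> 'a \<Rightarrow> nat \<Rightarrow> real" where
  "occupation i x a t = pmf (map_pmf (\<lambda>(s, a). (s i, a i)) (state_action_law t)) (x, a)"

text \<open>
  The occupation measure integrates every function of one arm's state and action; the constraints
  and the objective of the linear program are the instances for different weights \<open>w\<close>.
\<close>

lemma sum_occupation:
  assumes "i < num_arms B" "t < horizon B"
  shows "(\<Sum>x\<in>states B i. \<Sum>a\<in>actions B i. occupation i x a t * w x a)
         = expect (state_action_law t) (\<lambda>(s, a). w (s i) (a i))"
proof -
  let ?q = "map_pmf (\<lambda>(s, a). (s i, a i)) (state_action_law t)"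
  have "expect ?q (\<lambda>(x, a). w x a)
      = (\<Sum>(x, a)\<in>states B i \<times> actions B i. w x a * pmf ?q (x, a))"
    using assms set_state_action_law[of t] feas_action_component joint_state_component
    by (subst integral_measure_pmf_real[of "states B i \<times> actions B i"])
       (fastforce simp: finite_states finite_actions case_prod_unfold)+
  then show ?thesis
    by (simp add: sum.cartesian_product case_prod_unfold occupation_def mult.commute)
qed

lemma sum_occupation_state:
  assumes "i < num_arms B" "t < horizon B" "x \<in> states B i"
  shows "(\<Sum>a\<in>actions B i. occupation i x a t) = pmf (map_pmf (\<lambda>s. s i) (state_law t)) x"
proof -
  have "(\<Sum>a\<in>actions B i. occupation i x a t)
      = (\<Sum>y\<in>states B i. \<Sum>a\<in>actions B i. occupation i y a t * of_bool (y = x))"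
    using assms finite_states
    by (subst sum.remove[of _ x]) (auto intro!: sum.neutral)
  also have "\<dots> = expect (state_action_law t) (\<lambda>(s, a). of_bool (s i = x))"
    using assms by (simp add: sum_occupation)
  also have "\<dots> = expect (map_pmf fst (state_action_law t)) (\<lambda>s. of_bool (s i = x))"
    by (simp add: case_prod_unfold)
  also have "map_pmf fst (state_action_law t) = state_law t"
    by (simp add: state_action_law_def map_bind_pmf pmf.map_comp o_def bind_return_pmf')
  also have "expect (state_law t) (\<lambda>s. of_bool (s i = x))
      = expect (map_pmf (\<lambda>s. s i) (state_law t)) (indicator {x})"
    by (simp only: integral_map_pmf) (simp add: indicator_def)
  finally show ?thesis by (simp add: measure_pmf_single del: integral_map_pmf)
qed

lemma arm_state_law_Suc:
  assumes "i < num_arms B"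
  shows "map_pmf (\<lambda>s. s i) (state_law (Suc t))
         = bind_pmf (state_action_law t) (\<lambda>(s, a). kern B i (s i) (a i))"
  using assms
  by (simp add: map_bind_pmf joint_kern_def Pi_pmf_component state_action_law_def
      bind_assoc_pmf bind_map_pmf)

text \<open>
  The flow constraint holds because the components of the joint transition are independent, the
  budget constraint because a feasible action pulls at most \<open>max_pulls B\<close> arms in each period.
\<close>

lemma occupation_feasible:
  assumes "pmf \<pi>0 s0 = 1"
  shows "rlp_feasible B \<pi>0 occupation"
  unfolding rlp_feasible_def
proof (intro conjI allI ballI impI)
  fix i x a t
  show "0 \<le> occupation i x a t" by (simp add: occupation_def)
next
  fix i x t
  assume *: "i < num_arms B" "x \<in> states B i" "t < horizon B" "0 < t"
  then obtain t' where t': "t = Suc t'" by (cases t) auto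
  have "(\<Sum>a\<in>actions B i. occupation i x a t) = pmf (map_pmf (\<lambda>s. s i) (state_law (Suc t'))) x"
    using * t' by (simp add: sum_occupation_state del: state_law.simps)
  also have "\<dots> = expect (state_action_law t') (\<lambda>(s, a). pmf (kern B i (s i) (a i)) x)"
    using * by (simp only: arm_state_law_Suc pmf_bind) (simp add: case_prod_unfold)
  also have "\<dots> = (\<Sum>x'\<in>states B i. \<Sum>a'\<in>actions B i. occupation i x' a' t' * pmf (kern B i x' a') x)"
    using * t' by (simp add: sum_occupation)
  finally show "(\<Sum>a\<in>actions B i. occupation i x a t)
      = (\<Sum>x'\<in>states B i. \<Sum>a'\<in>actions B i. pmf (kern B i x' a') x * occupation i x' a' (t - 1))"
    using t' by (simp add: mult.commute)
next
  \<comment> \<open>instance of \<open>sum_occupation\<close> for the indicator of the idle action\<close>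
  have idle: "(\<Sum>x\<in>states B i. occupation i x (idle B i) t)
      = expect (state_action_law t) (\<lambda>(s, a). of_bool (a i = idle B i))"
    if "i < num_arms B" "t < horizon B" for i t
  proof -
    have "(\<Sum>x\<in>states B i. occupation i x (idle B i) t)
        = (\<Sum>x\<in>states B i. \<Sum>a\<in>actions B i. occupation i x a t * of_bool (a = idle B i))"
      using that finite_actions idle_action
      by (intro sum.cong refl, subst sum.remove[of _ "idle B i"]) (auto intro!: sum.neutral)
    then show ?thesis using that by (simp add: sum_occupation)
  qed
  have "(\<Sum>i<num_arms B. real (horizon B) - (\<Sum>x\<in>states B i. \<Sum>t<horizon B. occupation i x (idle B i) t))
      = (\<Sum>i<num_arms B. \<Sum>t<horizon B. 1 - (\<Sum>x\<in>states B i. occupation i x (idle B i) t))"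
    by (intro sum.cong refl) (subst sum.swap, simp add: sum_subtractf)
  also have "\<dots> = (\<Sum>t<horizon B. \<Sum>i<num_arms B.
        expect (state_action_law t) (\<lambda>(s, a). of_bool (a i \<noteq> idle B i)))"
  proof (subst sum.swap, intro sum.cong refl)
    fix t i assume "t \<in> {..<horizon B}" "i \<in> {..<num_arms B}"
    then have *: "i < num_arms B" "t < horizon B" by auto
    have "1 - (\<Sum>x\<in>states B i. occupation i x (idle B i) t)
        = expect (state_action_law t) (\<lambda>_. 1)
          - expect (state_action_law t) (\<lambda>(s, a). of_bool (a i = idle B i))"
      using * by (simp add: idle)
    also have "\<dots> = expect (state_action_law t) (\<lambda>p. 1 - (case p of (s, a) \<Rightarrow> of_bool (a i = idle B i)))"
      using * by (intro Bochner_Integration.integral_diff[symmetric] integrable_measure_pmf_finite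
          finite_set_state_action_law)
    also have "\<dots> = expect (state_action_law t) (\<lambda>(s, a). of_bool (a i \<noteq> idle B i))"
      by (intro expect_cong) auto
    finally show "1 - (\<Sum>x\<in>states B i. occupation i x (idle B i) t)
        = expect (state_action_law t) (\<lambda>(s, a). of_bool (a i \<noteq> idle B i))" .
  qed
  also have "\<dots> \<le> (\<Sum>t<horizon B. real (max_pulls B))"
  proof (intro sum_mono)
    fix t assume "t \<in> {..<horizon B}"
    then have t: "t < horizon B" by simp
    have "(\<Sum>i<num_arms B. expect (state_action_law t) (\<lambda>(s, a). of_bool (a i \<noteq> idle B i)))
        = expect (state_action_law t) (\<lambda>p. \<Sum>i<num_arms B. of_bool (snd p i \<noteq> idle B i))"
      using t by (subst expect_sum) (auto simp: finite_set_state_action_law case_prod_unfold)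
    also have "\<dots> \<le> expect (state_action_law t) (\<lambda>_. real (max_pulls B))"
    proof (intro expect_mono finite_set_state_action_law t)
      fix p assume "p \<in> set_pmf (state_action_law t)"
      then have "snd p \<in> feas_actions B" using set_state_action_law[OF t] by auto
      then have "card {i. i < num_arms B \<and> snd p i \<noteq> idle B i} \<le> max_pulls B"
        by (simp add: feas_actions_def)
      moreover have "{i. i < num_arms B \<and> snd p i \<noteq> idle B i}
          = {..<num_arms B} \<inter> {i. snd p i \<noteq> idle B i}" by auto
      ultimately show "(\<Sum>i<num_arms B. of_bool (snd p i \<noteq> idle B i)) \<le> real (max_pulls B)"
        by (simp add: sum_of_bool_eq)
    qed
    finally show "(\<Sum>i<num_arms B. expect (state_action_law t) (\<lambda>(s, a). of_bool (a i \<noteq> idle B i)))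
        \<le> real (max_pulls B)" by simp
  qed
  finally show "(\<Sum>i<num_arms B. real (horizon B)
        - (\<Sum>x\<in>states B i. \<Sum>t<horizon B. occupation i x (idle B i) t))
      \<le> real (max_pulls B) * real (horizon B)" by (simp add: mult.commute)
next
  fix i x
  assume *: "i < num_arms B" "x \<in> states B i"
  have p0: "\<pi>0 = return_pmf s0"
    using assms by (rule pmf_eq_1_imp_return)
  show "(\<Sum>a\<in>actions B i. occupation i x a 0) = (\<Sum>s\<in>{s \<in> joint_states B. s i = x}. pmf \<pi>0 s)"
    using * horizon_pos sum_return_pmf_component[OF s0] by (simp add: sum_occupation_state p0)
qed

lemma policy_value_eq_objective: "policy_value B \<mu> s0 = rlp_objective B occupation"
proof -
  have "policy_value B \<mu> s0 = (\<Sum>t<horizon B. expect (state_action_law t) (\<lambda>(s, a). joint_rew B s a))"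
    using expect_total_rew[of 0 "horizon B"] by (simp add: policy_value_def)
  also have "\<dots> = (\<Sum>t<horizon B. \<Sum>i<num_arms B.
        expect (state_action_law t) (\<lambda>(s, a). rew B i (s i) (a i)))"
    by (intro sum.cong refl)
       (simp add: joint_rew_def case_prod_unfold expect_sum finite_set_state_action_law)
  also have "\<dots> = (\<Sum>t<horizon B. \<Sum>i<num_arms B.
        \<Sum>x\<in>states B i. \<Sum>a\<in>actions B i. occupation i x a t * rew B i x a)"
    by (intro sum.cong refl) (simp add: sum_occupation)
  finally show ?thesis by (subst (asm) sum.swap) (simp add: rlp_objective_def)
qed

end

text \<open>
  A supremum over policies needs a feasible policy: idling all arms is one.
\<close>

lemma opt_value_le_objective:
  assumes "is_bandit B" "s0 \<in> joint_states B" "pmf \<pi>0 s0 = 1" "rlp_optimal B \<pi>0 \<pi>"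
  shows "opt_value B s0 \<le> rlp_objective B \<pi>"
  unfolding opt_value_def
proof (rule cSUP_least)
  interpret bandit_model B by standard fact
  have "(\<lambda>i\<in>{..<num_arms B}. idle B i) \<in> feas_actions B"
  proof -
    have "{i. i < num_arms B \<and> (\<lambda>i\<in>{..<num_arms B}. idle B i) i \<noteq> idle B i} = {}" by auto
    then have "card {i. i < num_arms B \<and> (\<lambda>i\<in>{..<num_arms B}. idle B i) i \<noteq> idle B i} = 0"
      by (simp only: card.empty)
    then show ?thesis
      by (auto simp: feas_actions_def joint_actions_def idle_action)
  qed
  then have "feas_policy B (\<lambda>_ _. return_pmf (\<lambda>i\<in>{..<num_arms B}. idle B i))"
    by (simp add: feas_policy_def)
  then show "{\<mu>. feas_policy B \<mu>} \<noteq> {}" by blast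
next
  fix \<mu> assume "\<mu> \<in> {\<mu>. feas_policy B \<mu>}"
  then interpret feasible_policy B \<mu> s0
    using assms by unfold_locales auto
  show "policy_value B \<mu> s0 \<le> rlp_objective B \<pi>"
    using assms(4) occupation_feasible[OF assms(3)]
    by (simp add: policy_value_eq_objective rlp_optimal_def)
qed

section \<open>The relaxed policy on a single arm\<close>

locale relaxed_policy = bandit_model B for B :: "('s, 'a) bandit" +
  fixes \<pi> :: "nat \<Rightarrow> 's \<Rightarrow> 'a \<Rightarrow> nat \<Rightarrow> real"
  assumes weight_nonneg:
    "i < num_arms B \<Longrightarrow> x \<in> states B i \<Longrightarrow> a \<in> actions B i \<Longrightarrow> t < horizon B \<Longrightarrow> 0 \<le> \<pi> i x a t"
begin

lemma pmf_relaxed_action: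
  assumes i: "i < num_arms B" and x: "x \<in> states B i" and t: "t < horizon B"
    and w: "(\<Sum>a\<in>actions B i. \<pi> i x a t) \<noteq> 0"
  shows "pmf (relaxed_action B \<pi> i x t) b =
    (if b \<in> actions B i then \<pi> i x b t / (\<Sum>a\<in>actions B i. \<pi> i x a t) else 0)"
proof -
  let ?w = "\<Sum>a\<in>actions B i. \<pi> i x a t"
  let ?f = "\<lambda>a. if a \<in> actions B i then \<pi> i x a t / ?w else 0"
  have nn: "0 \<le> \<pi> i x a t" if "a \<in> actions B i" for a
    using weight_nonneg i x t that by auto
  then have "0 \<le> ?w" by (intro sum_nonneg) auto
  then have f_nonneg: "0 \<le> ?f a" for a
    using nn by auto
  have "(\<integral>\<^sup>+a. ennreal (?f a) \<partial>count_space UNIV) = (\<Sum>a\<in>actions B i. ennreal (?f a))"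
    using finite_actions[OF i] by (intro nn_integral_count_space') auto
  also have "\<dots> = ennreal (\<Sum>a\<in>actions B i. ?f a)"
    by (intro sum_ennreal f_nonneg)
  also have "(\<Sum>a\<in>actions B i. ?f a) = 1"
    using w by (simp add: sum_divide_distrib[symmetric])
  finally have "pmf (embed_pmf ?f) b = ?f b"
    using f_nonneg by (intro pmf_embed_pmf) auto
  then show ?thesis using w by (simp add: relaxed_action_def)
qed

lemma set_relaxed_action:
  assumes "i < num_arms B" "x \<in> states B i" "t < horizon B"
  shows "set_pmf (relaxed_action B \<pi> i x t) \<subseteq> actions B i"
proof (cases "(\<Sum>a\<in>actions B i. \<pi> i x a t) = 0")
  case True
  then show ?thesis using assms idle_action by (simp add: relaxed_action_def)
next
  case False
  then show ?thesis
    using pmf_relaxed_action[OF assms False] by (auto simp: set_pmf_iff split: if_splits)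
qed

lemma finite_set_relaxed_action:
  assumes "i < num_arms B" "x \<in> states B i" "t < horizon B"
  shows "finite (set_pmf (relaxed_action B \<pi> i x t))"
  using set_relaxed_action[OF assms] finite_actions[OF assms(1)] by (rule finite_subset)

lemma set_relaxed_arm_traj:
  assumes "i < num_arms B"
  shows "x \<in> states B i \<Longrightarrow> t + m \<le> horizon B \<Longrightarrow> h \<in> set_pmf (relaxed_arm_traj B \<pi> i m t x) \<Longrightarrow>
    length h = m \<and> set h \<subseteq> states B i \<times> actions B i"
proof (induction m arbitrary: t x h)
  case (Suc m)
  from Suc.prems(3) obtain a y h' where *: "a \<in> set_pmf (relaxed_action B \<pi> i x t)"
    "y \<in> set_pmf (kern B i x a)" "h' \<in> set_pmf (relaxed_arm_traj B \<pi> i m (Suc t) y)"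
    "h = (x, a) # h'" by auto
  have "a \<in> actions B i" using *(1) Suc.prems(1,2) set_relaxed_action[of i x t] assms by auto
  moreover from this have "y \<in> states B i" using * Suc.prems set_kern assms by blast
  ultimately show ?case using Suc.IH[of y "Suc t" h'] * Suc.prems by auto
qed simp

lemma finite_set_relaxed_arm_traj:
  assumes "i < num_arms B" "x \<in> states B i" "t + m \<le> horizon B"
  shows "finite (set_pmf (relaxed_arm_traj B \<pi> i m t x))"
  by (rule finite_subset[OF _ finite_lists_length_eq[of "states B i \<times> actions B i" m]])
     (use assms set_relaxed_arm_traj[OF assms(1,2,3)] in \<open>auto simp: finite_states finite_actions\<close>)

lemma expect_relaxed_arm_traj_Suc:
  assumes i: "i < num_arms B" and x: "x \<in> states B i" and t: "t + Suc m \<le> horizon B"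
  shows "expect (relaxed_arm_traj B \<pi> i (Suc m) t x) F =
    expect (relaxed_action B \<pi> i x t) (\<lambda>a. expect (kern B i x a) (\<lambda>y.
      expect (relaxed_arm_traj B \<pi> i m (Suc t) y) (\<lambda>h. F ((x, a) # h))))"
proof -
  have a: "a \<in> actions B i" if "a \<in> set_pmf (relaxed_action B \<pi> i x t)" for a
    using that set_relaxed_action[of i x t] i x t by auto
  have fin: "finite (set_pmf (relaxed_arm_traj B \<pi> i m (Suc t) y))"
    if "y \<in> set_pmf (kern B i x a)" "a \<in> set_pmf (relaxed_action B \<pi> i x t)" for y a
    using finite_set_relaxed_arm_traj[of i y "Suc t" m] set_kern[of i x a] a that i x t by auto
  show ?thesis
    using i x t a fin
    by (auto simp: expect_bind finite_set_relaxed_action finite_set_kern intro!: expect_cong)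
qed

text \<open>
  If \<open>\<pi>\<close> describes the law of the state of arm \<open>i\<close> at time \<open>t\<close>, it describes the joint law of
  state and drawn action as well. In states where all weights vanish the arbitrary choice made by
  \<open>relaxed_action\<close> does not matter, as these states have probability zero.
\<close>

lemma expect_weights:
  assumes i: "i < num_arms B" and t: "t < horizon B"
    and p: "set_pmf p \<subseteq> states B i" "\<And>x. x \<in> states B i \<Longrightarrow> pmf p x = (\<Sum>a\<in>actions B i. \<pi> i x a t)"
  shows "expect p (\<lambda>x. expect (relaxed_action B \<pi> i x t) (f x))
    = (\<Sum>x\<in>states B i. \<Sum>a\<in>actions B i. \<pi> i x a t * f x a)"
proof -
  have "expect p (\<lambda>x. expect (relaxed_action B \<pi> i x t) (f x))
      = (\<Sum>x\<in>states B i. expect (relaxed_action B \<pi> i x t) (f x) * pmf p x)"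
    using p finite_states[OF i] by (intro integral_measure_pmf_real) auto
  also have "\<dots> = (\<Sum>x\<in>states B i. \<Sum>a\<in>actions B i. \<pi> i x a t * f x a)"
  proof (intro sum.cong refl)
    fix x assume x: "x \<in> states B i"
    show "expect (relaxed_action B \<pi> i x t) (f x) * pmf p x = (\<Sum>a\<in>actions B i. \<pi> i x a t * f x a)"
    proof (cases "(\<Sum>a\<in>actions B i. \<pi> i x a t) = 0")
      case True
      then have "\<pi> i x a t = 0" if "a \<in> actions B i" for a
        using that finite_actions[OF i] weight_nonneg[OF i x _ t]
        by (subst (asm) sum_nonneg_eq_0_iff) auto
      then show ?thesis using p x True by simp
    next
      case False
      have "expect (relaxed_action B \<pi> i x t) (f x)
          = (\<Sum>a\<in>actions B i. f x a * pmf (relaxed_action B \<pi> i x t) a)"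
        using set_relaxed_action[OF i x t] finite_actions[OF i]
        by (intro integral_measure_pmf_real) auto
      then show ?thesis
        using False p x
        by (simp add: pmf_relaxed_action[OF i x t] sum_divide_distrib[symmetric] mult.commute)
    qed
  qed
  finally show ?thesis .
qed

definition traj_rew :: "nat \<Rightarrow> ('s \<times> 'a) list \<Rightarrow> real" where
  "traj_rew i h = (\<Sum>(x, a)\<leftarrow>h. rew B i x a)"

text \<open>
  The flow constraint of the linear program propagates the agreement between \<open>\<pi>\<close> and the law of
  the relaxed arm from one time to the next. The premise on \<open>p\<close> is conditional on \<open>t < horizon B\<close>
  so that the induction also covers the law reached after the last period.
\<close>

lemma expect_traj_rew:
  assumes i: "i < num_arms B"
    and flow: "\<And>x t. x \<in> states B i \<Longrightarrow> Suc t < horizon B \<Longrightarrow>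
        (\<Sum>a\<in>actions B i. \<pi> i x a (Suc t)) =
        (\<Sum>x'\<in>states B i. \<Sum>a'\<in>actions B i. pmf (kern B i x' a') x * \<pi> i x' a' t)"
  shows "set_pmf p \<subseteq> states B i \<Longrightarrow>
    (t < horizon B \<Longrightarrow> \<forall>x\<in>states B i. pmf p x = (\<Sum>a\<in>actions B i. \<pi> i x a t)) \<Longrightarrow>
    t + m \<le> horizon B \<Longrightarrow>
    expect p (\<lambda>x. expect (relaxed_arm_traj B \<pi> i m t x) (traj_rew i))
    = (\<Sum>j<m. \<Sum>x\<in>states B i. \<Sum>a\<in>actions B i. \<pi> i x a (t + j) * rew B i x a)"
proof (induction m arbitrary: p t)
  case 0
  then show ?case by (simp add: traj_rew_def)
next
  case (Suc m)
  let ?f = "\<lambda>y. expect (relaxed_arm_traj B \<pi> i m (Suc t) y) (traj_rew i)"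
  let ?p = "bind_pmf p (\<lambda>x. bind_pmf (relaxed_action B \<pi> i x t) (kern B i x))"
  have t: "t < horizon B" using Suc.prems by auto
  have p: "set_pmf p \<subseteq> states B i" "\<And>x. x \<in> states B i \<Longrightarrow> pmf p x = (\<Sum>a\<in>actions B i. \<pi> i x a t)"
    using Suc.prems t by auto
  have finp: "finite (set_pmf p)" using p finite_states[OF i] finite_subset by auto
  have act: "a \<in> actions B i" if "a \<in> set_pmf (relaxed_action B \<pi> i x t)" "x \<in> states B i" for a x
    using that set_relaxed_action[of i x t] i t by auto
  have step: "expect (relaxed_arm_traj B \<pi> i (Suc m) t x) (traj_rew i)
      = expect (relaxed_action B \<pi> i x t) (rew B i x)
        + expect (bind_pmf (relaxed_action B \<pi> i x t) (kern B i x)) ?f"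
    if x: "x \<in> states B i" for x
  proof -
    have "expect (relaxed_arm_traj B \<pi> i (Suc m) t x) (traj_rew i)
        = expect (relaxed_action B \<pi> i x t) (\<lambda>a. expect (kern B i x a) (\<lambda>y.
            expect (relaxed_arm_traj B \<pi> i m (Suc t) y) (\<lambda>h. rew B i x a + traj_rew i h)))"
      using expect_relaxed_arm_traj_Suc[OF i x, of t m "traj_rew i"] Suc.prems
      by (simp add: traj_rew_def del: relaxed_arm_traj.simps)
    also have "\<dots> = expect (relaxed_action B \<pi> i x t) (\<lambda>a. rew B i x a + expect (kern B i x a) ?f)"
    proof (intro expect_cong)
      fix a assume "a \<in> set_pmf (relaxed_action B \<pi> i x t)"
      then have a: "a \<in> actions B i" using act x by auto
      have "expect (kern B i x a) (\<lambda>y.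
            expect (relaxed_arm_traj B \<pi> i m (Suc t) y) (\<lambda>h. rew B i x a + traj_rew i h))
          = expect (kern B i x a) (\<lambda>y. rew B i x a + ?f y)"
        using i x a set_kern[of i x a] Suc.prems
        by (intro expect_cong, subst expect_add) (auto intro!: finite_set_relaxed_arm_traj)
      then show "expect (kern B i x a) (\<lambda>y.
            expect (relaxed_arm_traj B \<pi> i m (Suc t) y) (\<lambda>h. rew B i x a + traj_rew i h))
          = rew B i x a + expect (kern B i x a) ?f"
        using i x a by (simp add: expect_add finite_set_kern)
    qed
    finally show ?thesis
      using i x t act by (simp add: expect_add expect_bind finite_set_relaxed_action finite_set_kern)
  qed
  have fin: "finite (set_pmf (bind_pmf (relaxed_action B \<pi> i x t) (kern B i x)))"
    if "x \<in> set_pmf p" for x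
    using that i t p act[of _ x] finite_set_relaxed_action[of i x t] by (auto intro!: finite_set_kern)
  have setp': "set_pmf ?p \<subseteq> states B i"
    using p act set_kern[OF i] by fastforce
  have pmfp': "pmf ?p y = (\<Sum>a\<in>actions B i. \<pi> i y a (Suc t))"
    if "y \<in> states B i" "Suc t < horizon B" for y
    using flow[OF that] expect_weights[OF i t p, of "\<lambda>x a. pmf (kern B i x a) y"]
    by (simp add: pmf_bind mult.commute)
  have "expect p (\<lambda>x. expect (relaxed_arm_traj B \<pi> i (Suc m) t x) (traj_rew i))
      = expect p (\<lambda>x. expect (relaxed_action B \<pi> i x t) (rew B i x)
          + expect (bind_pmf (relaxed_action B \<pi> i x t) (kern B i x)) ?f)"
    using p step by (intro expect_cong) auto
  also have "\<dots> = expect p (\<lambda>x. expect (relaxed_action B \<pi> i x t) (rew B i x)) + expect ?p ?f"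
    using finp fin by (simp add: expect_add expect_bind[of p])
  also have "expect ?p ?f
      = (\<Sum>j<m. \<Sum>x\<in>states B i. \<Sum>a\<in>actions B i. \<pi> i x a (Suc t + j) * rew B i x a)"
    using setp' pmfp' Suc.prems by (intro Suc.IH) auto
  finally show ?case
    using expect_weights[OF i t p, of "rew B i"]
    by (simp add: sum.lessThan_Suc_shift del: sum.lessThan_Suc)
qed

text \<open>
  The reward of the first \<open>q\<close> pulls and the number of pulls, by recursion on the trajectory. Both
  skip idle steps, which is what the inner loop of the heuristic does.
\<close>

fun first_rew :: "nat \<Rightarrow> nat \<Rightarrow> ('s \<times> 'a) list \<Rightarrow> real" where
  "first_rew i q [] = 0"
| "first_rew i q ((x, a) # h) =
     (if a = idle B i then first_rew i q h
      else case q of 0 \<Rightarrow> 0 | Suc q' \<Rightarrow> rew B i x a + first_rew i q' h)"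

fun pull_count :: "nat \<Rightarrow> ('s \<times> 'a) list \<Rightarrow> real" where
  "pull_count i [] = 0"
| "pull_count i ((x, a) # h) = (if a = idle B i then 0 else 1) + pull_count i h"

lemma first_rew_0: "first_rew i 0 h = 0"
  by (induction i "0::nat" h rule: first_rew.induct) auto

lemma first_rew_eq:
  "i < num_arms B \<Longrightarrow> set h \<subseteq> states B i \<times> actions B i \<Longrightarrow>
    first_rew i m h = (\<Sum>l<length h. of_bool (pulls_upto B i h l \<le> m) * rew B i (fst (h ! l)) (snd (h ! l)))"
proof (induction i m h rule: first_rew.induct)
  case (2 i q x a h)
  have shift: "pulls_upto B i ((x, a) # h) (Suc l) = of_bool (a \<noteq> idle B i) + pulls_upto B i h l" for l
    by (simp add: pulls_upto_def sum.atMost_Suc_shift del: sum.atMost_Suc)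
  have nth: "(\<Sum>l<length ((x, a) # h). of_bool (pulls_upto B i ((x, a) # h) l \<le> q)
        * rew B i (fst (((x, a) # h) ! l)) (snd (((x, a) # h) ! l)))
      = of_bool (of_bool (a \<noteq> idle B i) \<le> q) * rew B i x a
        + (\<Sum>l<length h. of_bool (of_bool (a \<noteq> idle B i) + pulls_upto B i h l \<le> q)
            * rew B i (fst (h ! l)) (snd (h ! l)))"
    by (simp add: sum.lessThan_Suc_shift shift del: sum.lessThan_Suc) (simp add: pulls_upto_def)
  show ?case
    unfolding nth using 2 rew_idle[of i x] by (auto split: nat.splits)
qed simp

lemma arm_pulls_eq:
  "length h = horizon B \<Longrightarrow> real (arm_pulls B i h) = pull_count i h"
proof -
  have "(\<Sum>t<length h. of_bool (snd (h ! t) \<noteq> idle B i)) = pull_count i h"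
    by (induction i h rule: pull_count.induct)
       (auto simp: sum.lessThan_Suc_shift simp del: sum.lessThan_Suc)
  then show "length h = horizon B \<Longrightarrow> ?thesis" by (simp add: arm_pulls_def)
qed

text \<open>
  \<open>rew_value i q l x\<close> is the reward that arm \<open>i\<close> is expected to earn with at most \<open>q\<close> further pulls
  when it is in state \<open>x\<close> at local time \<open>l\<close>; \<open>pull_value i l x\<close> is the expected number of pulls
  that the relaxed policy makes from there.
\<close>

definition rew_value :: "nat \<Rightarrow> nat \<Rightarrow> nat \<Rightarrow> 's \<Rightarrow> real" where
  "rew_value i q l x = expect (relaxed_arm_traj B \<pi> i (horizon B - l) l x) (first_rew i q)"

definition pull_value :: "nat \<Rightarrow> nat \<Rightarrow> 's \<Rightarrow> real" where
  "pull_value i l x = expect (relaxed_arm_traj B \<pi> i (horizon B - l) l x) (pull_count i)"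

lemma set_draw_action:
  assumes i: "i < num_arms B" and x: "x \<in> states B i"
  shows "l \<le> horizon B \<Longrightarrow> set_pmf (draw_action B \<pi> i x l) \<subseteq> actions B i \<times> {..horizon B}"
proof (induction "horizon B - l" arbitrary: l)
  case 0
  then show ?case using i idle_action by (subst draw_action.simps) auto
next
  case (Suc d)
  then have "set_pmf (draw_action B \<pi> i x (Suc l)) \<subseteq> actions B i \<times> {..horizon B}" by auto
  then show ?case
    using set_relaxed_action[OF i x, of l] Suc.hyps(2)
    by (subst draw_action.simps) (auto split: if_splits)
qed

lemma finite_set_draw_action:
  assumes "i < num_arms B" "x \<in> states B i" "l \<le> horizon B"
  shows "finite (set_pmf (draw_action B \<pi> i x l))"
  by (rule finite_subset[OF set_draw_action[OF assms]])
     (use finite_actions[OF assms(1)] in auto)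

text \<open>
  This links the heuristic to the relaxed policy: an idle step leaves the state unchanged, so that
  for a functional \<open>F\<close> which ignores such steps the relaxed trajectory may be advanced directly to
  its next pull, and the law of that pull is \<open>draw_action\<close>. The functional \<open>G\<close> applied after the
  pull may differ from \<open>F\<close>: for \<open>first_rew\<close> it has one pull less to count.
\<close>

lemma expect_traj_draw:
  assumes i: "i < num_arms B" and x: "x \<in> states B i"
    and F_Nil: "F [] = 0"
    and F_idle: "\<And>h. F ((x, idle B i) # h) = F h"
    and F_pull: "\<And>a h. a \<noteq> idle B i \<Longrightarrow> F ((x, a) # h) = w a + G h"
  shows "l \<le> horizon B \<Longrightarrow> expect (relaxed_arm_traj B \<pi> i (horizon B - l) l x) F =
    expect (draw_action B \<pi> i x l) (\<lambda>(a, l'). if a = idle B i then 0 else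
      w a + expect (kern B i x a) (\<lambda>y. expect (relaxed_arm_traj B \<pi> i (horizon B - l') l' y) G))"
    (is "_ \<Longrightarrow> _ = expect _ ?g")
proof (induction "horizon B - l" arbitrary: l)
  case 0
  then show ?case by (subst draw_action.simps) (simp add: F_Nil)
next
  case (Suc d)
  then have l: "l < horizon B" "horizon B - l = Suc (horizon B - Suc l)" by auto
  have "expect (relaxed_arm_traj B \<pi> i (horizon B - l) l x) F
      = expect (relaxed_action B \<pi> i x l) (\<lambda>a. expect (kern B i x a) (\<lambda>y.
          expect (relaxed_arm_traj B \<pi> i (horizon B - Suc l) (Suc l) y) (\<lambda>h. F ((x, a) # h))))"
    unfolding l(2) using l(1) by (intro expect_relaxed_arm_traj_Suc[OF i x]) auto
  also have "\<dots> = expect (relaxed_action B \<pi> i x l) (\<lambda>a. expect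
      (if a = idle B i then draw_action B \<pi> i x (Suc l) else return_pmf (a, Suc l)) ?g)"
  proof (intro expect_cong)
    fix a assume "a \<in> set_pmf (relaxed_action B \<pi> i x l)"
    then have a: "a \<in> actions B i" using set_relaxed_action[OF i x l(1)] by auto
    show "expect (kern B i x a) (\<lambda>y.
          expect (relaxed_arm_traj B \<pi> i (horizon B - Suc l) (Suc l) y) (\<lambda>h. F ((x, a) # h)))
        = expect (if a = idle B i then draw_action B \<pi> i x (Suc l) else return_pmf (a, Suc l)) ?g"
    proof (cases "a = idle B i")
      case True
      then show ?thesis
        using Suc.hyps l by (simp add: kern_idle[OF i x] F_idle)
    next
      case False
      have "expect (kern B i x a) (\<lambda>y.
          expect (relaxed_arm_traj B \<pi> i (horizon B - Suc l) (Suc l) y) (\<lambda>h. w a + G h))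
        = expect (kern B i x a) (\<lambda>y.
          w a + expect (relaxed_arm_traj B \<pi> i (horizon B - Suc l) (Suc l) y) G)"
        using i x a set_kern[of i x a] l
        by (intro expect_cong, subst expect_add) (auto intro!: finite_set_relaxed_arm_traj)
      with False show ?thesis
        using i x a by (simp add: F_pull expect_add finite_set_kern)
    qed
  qed
  also have "\<dots> = expect (draw_action B \<pi> i x l) ?g"
    using l i x
    by (subst (2) draw_action.simps)
       (simp add: expect_bind finite_set_relaxed_action finite_set_draw_action)
  finally show ?case .
qed

lemma rew_value_draw:
  assumes "i < num_arms B" "x \<in> states B i" "l \<le> horizon B"
  shows "rew_value i (Suc q) l x = expect (draw_action B \<pi> i x l) (\<lambda>(a, l').
    if a = idle B i then 0 else rew B i x a + expect (kern B i x a) (rew_value i q l'))"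
  unfolding rew_value_def using assms by (intro expect_traj_draw) auto

lemma pull_value_draw:
  assumes "i < num_arms B" "x \<in> states B i" "l \<le> horizon B"
  shows "pull_value i l x = expect (draw_action B \<pi> i x l) (\<lambda>(a, l').
    if a = idle B i then 0 else 1 + expect (kern B i x a) (pull_value i l'))"
  unfolding pull_value_def using assms by (intro expect_traj_draw) auto

lemma pull_value_nonneg: "0 \<le> pull_value i l x"
proof -
  have "0 \<le> pull_count i h" for h by (induction i h rule: pull_count.induct) auto
  then show ?thesis unfolding pull_value_def by (intro expect_nonneg) auto
qed

lemma rew_value_nonneg:
  assumes "i < num_arms B" "x \<in> states B i" "l \<le> horizon B"
  shows "0 \<le> rew_value i q l x"
proof -
  have "0 \<le> first_rew i q h" if "set h \<subseteq> states B i \<times> actions B i" for h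
    using that assms(1) by (induction i q h rule: first_rew.induct)
      (auto split: nat.splits intro!: add_nonneg_nonneg rew_nonneg)
  then show ?thesis
    unfolding rew_value_def using assms set_relaxed_arm_traj[of i x l "horizon B - l"]
    by (intro expect_nonneg) auto
qed

lemma rew_value_0: "rew_value i 0 l x = 0"
  by (simp add: rew_value_def first_rew_0[abs_def])

end

section \<open>The potential of the packing heuristic\<close>

text \<open>
  A concave sequence that starts at zero lies above its chord.
\<close>

lemma concave_ratio:
  fixes g :: "nat \<Rightarrow> real"
  assumes g0: "g 0 = 0"
    and dec: "\<And>m. 0 < m \<Longrightarrow> m < T \<Longrightarrow> g (m + 1) - g m \<le> g m - g (m - 1)"
    and "m \<le> T"
  shows "real m * g T \<le> real T * g m"
proof (cases "m = 0")
  case True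
  then show ?thesis using g0 by simp
next
  case False
  \<comment> \<open>each of the first \<open>m\<close> increments is at least the next one\<close>
  have slope: "real m * (g (Suc m) - g m) \<le> g m" if "m < T" for m
    using that
  proof (induction m)
    case (Suc m)
    have "real (Suc m) * (g (Suc (Suc m)) - g (Suc m)) \<le> real (Suc m) * (g (Suc m) - g m)"
      using dec[of "Suc m"] Suc.prems by (intro mult_left_mono) auto
    then show ?case using Suc by (simp add: algebra_simps)
  qed (use g0 in simp)
  have step: "real m * g (Suc n) \<le> real (Suc n) * g m"
    if "real m * g n \<le> real n * g m" "n < T" "0 < n" for n
  proof -
    have "real n * (real m * g (Suc n)) \<le> real m * (real (Suc n) * g n)"
      using mult_left_mono[OF slope[OF that(2)], of "real m"] by (simp add: algebra_simps)
    also have "\<dots> \<le> real (Suc n) * (real n * g m)"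
      using mult_left_mono[OF that(1), of "real (Suc n)"] by (simp add: mult.left_commute)
    finally have "real n * (real m * g (Suc n)) \<le> real n * (real (Suc n) * g m)"
      by (simp only: mult.left_commute)
    then show ?thesis using that(3) by simp
  qed
  have "real m * g n \<le> real n * g m" if "m \<le> n" "n \<le> T" for n
    using that by (induction n rule: dec_induct) (use False step in auto)
  then show ?thesis using assms(3) by simp
qed

locale packing = relaxed_policy B \<pi>
  for B :: "('s, 'a) bandit" and \<pi> :: "nat \<Rightarrow> 's \<Rightarrow> 'a \<Rightarrow> nat \<Rightarrow> real" +
  fixes s0 :: "nat \<Rightarrow> 's" and pick :: "('s, 'a) pack_conf \<Rightarrow> nat"
  assumes s0: "s0 \<in> joint_states B"
    and decreasing: "decreasing_returns B \<pi> s0"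
    and pick: "pick_rule B pick"
begin

abbreviation "R i \<equiv> exp_rew B \<pi> s0 i"
abbreviation "N i \<equiv> exp_pulls B \<pi> s0 i"

lemma s0_state: "i < num_arms B \<Longrightarrow> s0 i \<in> states B i"
  using s0 joint_state_component by auto

lemma expect_relaxed_traj:
  assumes "i < num_arms B"
  shows "expect (relaxed_traj B \<pi> s0) (\<lambda>h. f (h i)) =
    expect (relaxed_arm_traj B \<pi> i (horizon B) 0 (s0 i)) f"
  unfolding relaxed_traj_def using assms by (intro expect_Pi_pmf_component) auto

lemma exp_rew_first_eq:
  assumes i: "i < num_arms B"
  shows "exp_rew_first B \<pi> s0 i m = rew_value i m 0 (s0 i)"
proof -
  have "arm_rew_first B i m h = first_rew i m h"
    if "h \<in> set_pmf (relaxed_arm_traj B \<pi> i (horizon B) 0 (s0 i))" for h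
    using set_relaxed_arm_traj[OF i s0_state[OF i] _ that] first_rew_eq[OF i, of h m]
    by (auto simp: arm_rew_first_def)
  then show ?thesis
    unfolding exp_rew_first_def expect_relaxed_traj[OF i] rew_value_def
    by (auto intro: expect_cong)
qed

lemma exp_rew_eq:
  assumes i: "i < num_arms B"
  shows "R i = rew_value i (horizon B) 0 (s0 i)"
proof -
  have "pulls_upto B i h l \<le> horizon B" if "l < horizon B" for l h
  proof -
    have "pulls_upto B i h l \<le> (\<Sum>t\<le>l. 1)" unfolding pulls_upto_def by (intro sum_mono) auto
    then show ?thesis using that by simp
  qed
  then have "arm_rew B i h = arm_rew_first B i (horizon B) h" for h
    by (simp add: arm_rew_def arm_rew_first_def)
  then show ?thesis
    using exp_rew_first_eq[OF i] by (simp add: exp_rew_def exp_rew_first_def)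
qed

lemma exp_pulls_eq:
  assumes i: "i < num_arms B"
  shows "N i = pull_value i 0 (s0 i)"
  unfolding exp_pulls_def expect_relaxed_traj[OF i, where f = "\<lambda>h. real (arm_pulls B i h)"] pull_value_def
  using set_relaxed_arm_traj[OF i s0_state[OF i]]
  by (auto intro!: expect_cong arm_pulls_eq simp del: relaxed_arm_traj.simps)

lemma exp_rew_nonneg: "i < num_arms B \<Longrightarrow> 0 \<le> R i"
  by (simp add: exp_rew_eq rew_value_nonneg s0_state)

lemma exp_pulls_nonneg: "i < num_arms B \<Longrightarrow> 0 \<le> N i"
  by (simp add: exp_pulls_eq pull_value_nonneg)

text \<open>
  The only use of decreasing returns: cutting an arm off after \<open>m\<close> pulls keeps at least the
  fraction \<open>m / horizon B\<close> of its expected reward.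
\<close>

lemma rew_value_ge:
  assumes i: "i < num_arms B" and m: "m \<le> horizon B"
  shows "R i / horizon B * m \<le> rew_value i m 0 (s0 i)"
proof -
  have "real m * rew_value i (horizon B) 0 (s0 i) \<le> real (horizon B) * rew_value i m 0 (s0 i)"
    using decreasing i m
    by (intro concave_ratio) (auto simp: rew_value_0 decreasing_returns_def exp_rew_first_eq)
  then show ?thesis
    using horizon_pos by (simp add: exp_rew_eq[OF i] field_simps)
qed

text \<open>
  Expected future reward and number of pulls of an active arm with designated action \<open>a\<close>. The idle
  action means that no pull has been drawn yet; otherwise the designated pull is still to come.
\<close>

definition gain :: "nat \<Rightarrow> nat \<Rightarrow> 'a \<Rightarrow> nat \<Rightarrow> 's \<Rightarrow> real" where
  "gain i m a l x = (if a = idle B i then rew_value i m l x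
     else case m of 0 \<Rightarrow> 0 | Suc m' \<Rightarrow> rew B i x a + expect (kern B i x a) (rew_value i m' l))"

definition load :: "nat \<Rightarrow> 'a \<Rightarrow> nat \<Rightarrow> 's \<Rightarrow> real" where
  "load i a l x = (if a = idle B i then pull_value i l x
     else 1 + expect (kern B i x a) (pull_value i l))"

lemma load_nonneg: "0 \<le> load i a l x"
  by (auto simp: load_def pull_value_nonneg intro!: add_nonneg_nonneg expect_nonneg)

lemma gain_exhausted: "gain i m (idle B i) (horizon B) x = 0"
  by (simp add: gain_def rew_value_def)

lemma load_exhausted: "load i (idle B i) (horizon B) x = 0"
  by (simp add: load_def pull_value_def)

lemma draw_action_exhausted:
  assumes "i < num_arms B" "x \<in> states B i" "l \<le> horizon B" "(idle B i, l') \<in> set_pmf (draw_action B \<pi> i x l)"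
  shows "l' = horizon B"
  using draw_action_exit[OF assms(4)] set_draw_action[OF assms(1-3)] assms(4) by auto

text \<open>
  Drawing the designated action reveals information without changing expectations. An arm that
  exhausts its local time without a pull ends with the idle action at local time \<open>horizon B\<close>, where
  its gain and its load vanish.
\<close>

lemma expect_gain_draw:
  assumes "i < num_arms B" "x \<in> states B i" "l \<le> horizon B"
  shows "expect (draw_action B \<pi> i x l) (\<lambda>(a, l'). gain i (Suc m) a l' x) = gain i (Suc m) (idle B i) l x"
proof -
  have "gain i (Suc m) (idle B i) l x = rew_value i (Suc m) l x" by (simp add: gain_def)
  also have "\<dots> = expect (draw_action B \<pi> i x l) (\<lambda>(a, l'). gain i (Suc m) a l' x)"
    unfolding rew_value_draw[OF assms]
    using draw_action_exhausted[OF assms] gain_exhausted[of i "Suc m" x]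
    by (intro expect_cong) (auto simp: gain_def)
  finally show ?thesis ..
qed

lemma expect_load_draw:
  assumes "i < num_arms B" "x \<in> states B i" "l \<le> horizon B"
  shows "expect (draw_action B \<pi> i x l) (\<lambda>(a, l'). load i a l' x) = load i (idle B i) l x"
proof -
  have "load i (idle B i) l x = pull_value i l x" by (simp add: load_def)
  also have "\<dots> = expect (draw_action B \<pi> i x l) (\<lambda>(a, l'). load i a l' x)"
    unfolding pull_value_draw[OF assms]
    using draw_action_exhausted[OF assms] load_exhausted[of i x]
    by (intro expect_cong) (auto simp: load_def)
  finally show ?thesis ..
qed

text \<open>
  The guaranteed reward of the waiting arms when \<open>m\<close> periods remain and \<open>L\<close> pulls are expected
  before the head of the list can start. The factor \<open>m - L / max_pulls B\<close> bounds from below the number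
  of periods left to that arm; it is not truncated at zero, which keeps the term affine in \<open>L\<close>.
\<close>

fun queue_gain :: "nat \<Rightarrow> real \<Rightarrow> nat list \<Rightarrow> real" where
  "queue_gain m L [] = 0"
| "queue_gain m L (j # js) =
     R j / horizon B * (m - L / max_pulls B) + queue_gain m (L + N j) js"

text \<open>
  Affinity in \<open>L\<close>: this is what makes knowledge of the expected load sufficient.
\<close>

lemma expect_queue_gain:
  assumes "finite (set_pmf p)"
  shows "expect p (\<lambda>x. queue_gain m (f x) js) = queue_gain m (expect p f) js"
proof (induction js arbitrary: f)
  case (Cons j js)
  have int: "integrable p g" for g :: "_ \<Rightarrow> real" using assms by (rule integrable_measure_pmf_finite)
  have "expect p (\<lambda>x. f x + N j) = expect p f + N j"
    using assms by (simp add: expect_add)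
  then show ?case
    using assms Cons.IH[of "\<lambda>x. f x + N j"]
    by (simp add: expect_add int Bochner_Integration.integral_diff)
qed simp

text \<open>
  A period in which \<open>max_pulls B\<close> pulls are made delays no waiting arm.
\<close>

lemma queue_gain_Suc:
  fixes L :: real
  shows "queue_gain (Suc m) (L + max_pulls B) js = queue_gain m L js"
proof (induction js arbitrary: L)
  case (Cons j js)
  have "queue_gain (Suc m) (L + max_pulls B + N j) js = queue_gain m (L + N j) js"
    using Cons.IH[of "L + N j"] by (simp add: add_ac)
  then show ?case
    using max_pulls_pos by (simp add: add_divide_distrib)
qed simp

lemma queue_gain_0_nonpos:
  "set js \<subseteq> {..<num_arms B} \<Longrightarrow> 0 \<le> L \<Longrightarrow> queue_gain 0 L js \<le> 0"
proof (induction js arbitrary: L)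
  case (Cons j js)
  have "queue_gain 0 (L + N j) js \<le> 0" using Cons exp_pulls_nonneg by auto
  moreover have "0 \<le> R j / horizon B * (L / max_pulls B)"
    using Cons.prems exp_rew_nonneg by auto
  ultimately show ?case by simp
qed simp

text \<open>
  Promoting a waiting arm never lowers the potential: it now has all \<open>m\<close> remaining periods.
\<close>

lemma queue_head_le:
  assumes "j < num_arms B" "0 \<le> L" "m \<le> horizon B"
  shows "R j / horizon B * (m - L / max_pulls B) \<le> rew_value j m 0 (s0 j)"
proof -
  have "R j / horizon B * (m - L / max_pulls B) \<le> R j / horizon B * m"
    using assms exp_rew_nonneg by (intro mult_left_mono) auto
  then show ?thesis using rew_value_ge[OF assms(1,3)] by simp
qed

text \<open>
  The invariant of the heuristic. Waiting arms are untouched, and arms wait only while all slots are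
  occupied.
\<close>

definition valid_conf :: "('s, 'a) pack_conf \<Rightarrow> bool" where
  "valid_conf c \<longleftrightarrow>
     active c \<subseteq> {..<num_arms B} \<and> distinct (avail c) \<and> set (avail c) \<subseteq> {..<num_arms B} \<and>
     active c \<inter> set (avail c) = {} \<and> (avail c \<noteq> [] \<longrightarrow> card (active c) = max_pulls B) \<and>
     (\<forall>j\<in>set (avail c). cur_state c j = s0 j \<and> local_time c j = 0 \<and> designated c j = idle B j) \<and>
     (\<forall>i<num_arms B. cur_state c i \<in> states B i \<and> designated c i \<in> actions B i \<and>
        local_time c i \<le> horizon B)"

lemma finite_active: "valid_conf c \<Longrightarrow> finite (active c)"
  by (auto simp: valid_conf_def intro: finite_subset)

definition potential :: "nat \<Rightarrow> ('s, 'a) pack_conf \<Rightarrow> real" where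
  "potential m c = (\<Sum>i\<in>active c. gain i m (designated c i) (local_time c i) (cur_state c i)) +
     queue_gain m (\<Sum>i\<in>active c. load i (designated c i) (local_time c i) (cur_state c i)) (avail c)"

lemma valid_update_arm:
  assumes c: "valid_conf c" and i: "i \<in> pending B c" and a: "a \<in> actions B i" and l: "l \<le> horizon B"
  shows "valid_conf (update_arm B i a l c)"
proof (cases "horizon B \<le> l \<and> a = idle B i")
  case False
  then show ?thesis
    using c i a l by (auto simp: update_arm_def valid_conf_def pending_def Let_def)
next
  case True
  show ?thesis
  proof (cases "avail c")
    case Nil
    then show ?thesis
      using c i a l by (auto simp: update_arm_def valid_conf_def pending_def Let_def discard_def)
  next
    case (Cons j js)
    have "card (insert j (active c - {i})) = card (active c)"
      using c i Cons finite_active[OF c] max_pulls_pos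
      by (subst card_insert_disjoint) (auto simp: valid_conf_def pending_def card_Suc_Diff1)
    then show ?thesis
      using c i a l Cons True
      by (auto simp: update_arm_def valid_conf_def pending_def Let_def discard_def)
  qed
qed

text \<open>
  For \<open>l = horizon B\<close> and the idle action arm \<open>i\<close> is discarded. It contributes nothing any more, and
  if some arm is waiting, the first one takes its place.
\<close>

lemma potential_update_arm:
  assumes c: "valid_conf c" and i: "i \<in> pending B c" and m: "m \<le> horizon B"
    and d: "a \<noteq> idle B i \<or> l = horizon B"
  defines "G \<equiv> \<Sum>j\<in>active c - {i}. gain j m (designated c j) (local_time c j) (cur_state c j)"
    and "L \<equiv> \<Sum>j\<in>active c - {i}. load j (designated c j) (local_time c j) (cur_state c j)"
  shows "gain i m a l (cur_state c i) + G + queue_gain m (load i a l (cur_state c i) + L) (avail c)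
    \<le> potential m (update_arm B i a l c)"
proof -
  have fin: "finite (active c)" using c by (rule finite_active)
  have i': "i \<in> active c" using i by (auto simp: pending_def)
  show ?thesis
  proof (cases "horizon B \<le> l \<and> a = idle B i")
    case False
    then show ?thesis
      using fin i' unfolding G_def L_def
      by (auto simp: potential_def update_arm_def Let_def sum.remove[of "active c" i])
  next
    case True
    then have "a = idle B i" "l = horizon B" using d by auto
    then have zero: "gain i m a l x = 0" "load i a l x = 0" for x
      by (simp_all add: gain_exhausted load_exhausted)
    show ?thesis
    proof (cases "avail c")
      case Nil
      then show ?thesis
        using True \<open>l = horizon B\<close> zero by (simp add: potential_def update_arm_def Let_def discard_def G_def)
    next
      case (Cons j js)
      have j: "j < num_arms B" "j \<notin> active c" "cur_state c j = s0 j" "local_time c j = 0"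
        "designated c j = idle B j"
        using c Cons by (auto simp: valid_conf_def)
      have ji: "j \<noteq> i" using j i' by auto
      have L: "0 \<le> L" unfolding L_def by (intro sum_nonneg load_nonneg)
      have "potential m (update_arm B i a l c)
          = rew_value j m 0 (s0 j) + G + queue_gain m (L + N j) js"
        using True Cons j fin ji
        by (simp add: potential_def update_arm_def Let_def discard_def G_def L_def
            gain_def[of j] load_def[of j] exp_pulls_eq add_ac)
      then show ?thesis
        using queue_head_le[OF j(1) L m] by (simp add: zero Cons)
    qed
  qed
qed

lemma potential_draw:
  assumes c: "valid_conf c" and i: "i \<in> pending B c" and m: "Suc m \<le> horizon B"
  shows "potential (Suc m) c \<le> expect (draw_action B \<pi> i (cur_state c i) (local_time c i))
    (\<lambda>d. potential (Suc m) (update_arm B i (fst d) (snd d) c))"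
proof -
  let ?x = "cur_state c i" and ?l = "local_time c i"
  let ?d = "draw_action B \<pi> i ?x ?l"
  let ?G = "\<Sum>j\<in>active c - {i}. gain j (Suc m) (designated c j) (local_time c j) (cur_state c j)"
  let ?L = "\<Sum>j\<in>active c - {i}. load j (designated c j) (local_time c j) (cur_state c j)"
  have i': "i < num_arms B" "i \<in> active c" "designated c i = idle B i"
    using i by (auto simp: pending_def)
  have x: "?x \<in> states B i" "?l \<le> horizon B" using c i' by (auto simp: valid_conf_def)
  note fin = finite_set_draw_action[OF i'(1) x]
  have "potential (Suc m) c = gain i (Suc m) (idle B i) ?l ?x + ?G
      + queue_gain (Suc m) (load i (idle B i) ?l ?x + ?L) (avail c)"
    using finite_active[OF c] i'
    by (simp add: potential_def sum.remove[of "active c" i])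
  also have "\<dots> = expect ?d (\<lambda>d. gain i (Suc m) (fst d) (snd d) ?x + ?G
      + queue_gain (Suc m) (load i (fst d) (snd d) ?x + ?L) (avail c))"
    using expect_gain_draw[OF i'(1) x] expect_load_draw[OF i'(1) x] fin
    by (simp add: expect_add expect_queue_gain case_prod_unfold)
  also have "\<dots> \<le> expect ?d (\<lambda>d. potential (Suc m) (update_arm B i (fst d) (snd d) c))"
    using draw_action_exhausted[OF i'(1) x]
    by (intro expect_mono fin potential_update_arm c i m) (metis prod.collapse)
  finally show ?thesis .
qed

text \<open>
  The bound of \<open>potential_draw\<close> survives the repetition of draws in step (1), by induction on the
  quantity that makes this loop terminate: each draw settles a pending arm or uses up a waiting one.
\<close>

lemma potential_le_designate:
  assumes m: "Suc m \<le> horizon B"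
  shows "valid_conf c \<Longrightarrow> finite (set_pmf (designate B \<pi> pick c)) \<and>
    (\<forall>c'\<in>set_pmf (designate B \<pi> pick c). valid_conf c' \<and> pending B c' = {}) \<and>
    potential (Suc m) c \<le> expect (designate B \<pi> pick c) (potential (Suc m))"
proof (induction "card (pending B c) + length (avail c)" arbitrary: c rule: less_induct)
  case less
  show ?case
  proof (cases "pick c \<in> pending B c")
    case False
    then have "pending B c = {}" using pick by (auto simp: pick_rule_def)
    then show ?thesis
      using less.prems by (subst (1 2 3) designate.simps) simp
  next
    case True
    let ?i = "pick c"
    let ?d = "draw_action B \<pi> ?i (cur_state c ?i) (local_time c ?i)"
    let ?u = "\<lambda>d. update_arm B ?i (fst d) (snd d) c"
    have i: "?i < num_arms B" using True by (auto simp: pending_def)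
    have x: "cur_state c ?i \<in> states B ?i" "local_time c ?i \<le> horizon B"
      using less.prems i by (auto simp: valid_conf_def)
    have eq: "designate B \<pi> pick c = bind_pmf ?d (\<lambda>d. designate B \<pi> pick (?u d))"
      using True by (subst designate.simps) (simp add: Let_def)
    have IH: "finite (set_pmf (designate B \<pi> pick (?u d))) \<and>
        (\<forall>c'\<in>set_pmf (designate B \<pi> pick (?u d)). valid_conf c' \<and> pending B c' = {}) \<and>
        potential (Suc m) (?u d) \<le> expect (designate B \<pi> pick (?u d)) (potential (Suc m))"
      if d: "d \<in> set_pmf ?d" for d
    proof (rule less.hyps)
      show "card (pending B (?u d)) + length (avail (?u d)) < card (pending B c) + length (avail c)"
        using draw_action_exit[of "fst d" "snd d" B \<pi> ?i "cur_state c ?i" "local_time c ?i"] d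
        by (intro pending_update_arm True) auto
      show "valid_conf (?u d)"
        using set_draw_action[OF i x] d by (intro valid_update_arm less.prems True) auto
    qed
    note fin = finite_set_draw_action[OF i x]
    have "potential (Suc m) c \<le> expect ?d (\<lambda>d. potential (Suc m) (?u d))"
      by (intro potential_draw less.prems True m)
    also have "\<dots> \<le> expect ?d (\<lambda>d. expect (designate B \<pi> pick (?u d)) (potential (Suc m)))"
      using IH by (intro expect_mono fin) auto
    also have "\<dots> = expect (designate B \<pi> pick c) (potential (Suc m))"
      unfolding eq using IH fin by (intro expect_bind[symmetric]) auto
    finally show ?thesis
      unfolding eq using IH fin by auto
  qed
qed

abbreviation next_conf :: "('s, 'a) pack_conf \<Rightarrow> (nat \<Rightarrow> 's) \<Rightarrow> ('s, 'a) pack_conf" where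
  "next_conf c s' \<equiv> c\<lparr>cur_state := s',
     designated := (\<lambda>i. if i \<in> active c then idle B i else designated c i)\<rparr>"

lemma pack_action_valid:
  "valid_conf c \<Longrightarrow> i < num_arms B \<Longrightarrow> pack_action B c i \<in> actions B i"
  by (auto simp: pack_action_def valid_conf_def idle_action)

lemma finite_set_pull:
  "valid_conf c \<Longrightarrow> finite (set_pmf (joint_kern B (cur_state c) (pack_action B c)))"
  by (intro finite_set_joint_kern pack_action_valid) (auto simp: valid_conf_def)

lemma valid_next_conf:
  assumes c: "valid_conf c" and s': "s' \<in> set_pmf (joint_kern B (cur_state c) (pack_action B c))"
  shows "valid_conf (next_conf c s')"
proof -
  have "set_pmf (joint_kern B (cur_state c) (pack_action B c)) \<subseteq> joint_states B"
    using c by (intro set_joint_kern pack_action_valid) (auto simp: valid_conf_def)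
  then have "s' i \<in> states B i" if "i < num_arms B" for i
    using s' that joint_state_component by auto
  moreover have "s' j = s0 j" if j: "j \<in> set (avail c)" for j
  proof -
    have j': "j < num_arms B" "j \<notin> active c" "cur_state c j = s0 j"
      using c j by (auto simp: valid_conf_def)
    then have "s' j \<in> set_pmf (kern B j (s0 j) (idle B j))"
      using s' by (auto simp: joint_kern_def set_Pi_pmf PiE_dflt_def pack_action_def)
    then show ?thesis using j' by (simp add: kern_idle s0_state)
  qed
  ultimately show ?thesis using c by (auto simp: valid_conf_def idle_action)
qed

text \<open>
  One period of pulls. Every active arm is pulled, so its gain splits into the reward collected now
  and the gain afterwards, and its load drops by one in expectation. If an arm is waiting, the
  total load thus drops by \<open>max_pulls B\<close>, which makes up for the period that has passed.
\<close>

lemma potential_pull: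
  assumes c: "valid_conf c" and none: "pending B c = {}"
  shows "potential (Suc m) c = joint_rew B (cur_state c) (pack_action B c)
    + expect (joint_kern B (cur_state c) (pack_action B c)) (\<lambda>s'. potential m (next_conf c s'))"
proof -
  let ?a = "designated c" and ?l = "local_time c" and ?x = "cur_state c"
  let ?K = "joint_kern B ?x (pack_action B c)"
  let ?G = "\<Sum>i\<in>active c. expect (kern B i (?x i) (?a i)) (rew_value i m (?l i))"
  let ?L = "\<Sum>i\<in>active c. expect (kern B i (?x i) (?a i)) (pull_value i (?l i))"
  have act: "i < num_arms B" "?a i \<noteq> idle B i" "pack_action B c i = ?a i" if "i \<in> active c" for i
    using that c none by (auto simp: valid_conf_def pending_def pack_action_def)
  have arm: "expect ?K (\<lambda>s'. f (s' i)) = expect (kern B i (?x i) (?a i)) f" if "i \<in> active c" for i f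
    using act[OF that] unfolding joint_kern_def by (subst expect_Pi_pmf_component) auto
  have rew: "joint_rew B ?x (pack_action B c) = (\<Sum>i\<in>active c. rew B i (?x i) (?a i))"
    unfolding joint_rew_def
    using c act by (intro sum.mono_neutral_cong_right)
      (auto simp: valid_conf_def pack_action_def rew_idle)
  have gain: "(\<Sum>i\<in>active c. gain i (Suc m) (?a i) (?l i) (?x i))
      = (\<Sum>i\<in>active c. rew B i (?x i) (?a i)) + ?G"
    using act by (simp add: gain_def sum.distrib)
  have load: "(\<Sum>i\<in>active c. load i (?a i) (?l i) (?x i)) = ?L + card (active c)"
    using act by (simp add: load_def sum.distrib)
  \<comment> \<open>for an empty queue both sides vanish, otherwise there are \<open>max_pulls B\<close> active arms\<close>
  have queue: "queue_gain (Suc m) (?L + card (active c)) (avail c) = queue_gain m ?L (avail c)"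
    using c queue_gain_Suc[of m ?L "avail c"] by (cases "avail c = []") (auto simp: valid_conf_def)
  have "expect ?K (\<lambda>s'. potential m (next_conf c s'))
      = expect ?K (\<lambda>s'. (\<Sum>i\<in>active c. rew_value i m (?l i) (s' i))
          + queue_gain m (\<Sum>i\<in>active c. pull_value i (?l i) (s' i)) (avail c))"
    by (simp add: potential_def gain_def load_def)
  also have "\<dots> = ?G + queue_gain m ?L (avail c)"
    using finite_set_pull[OF c] arm by (simp add: expect_add expect_sum expect_queue_gain)
  finally show ?thesis
    by (simp add: potential_def[of "Suc m"] gain load queue rew)
qed

lemma potential_le_pack_traj:
  "m \<le> horizon B \<Longrightarrow> valid_conf c \<Longrightarrow> finite (set_pmf (pack_traj B \<pi> pick m c)) \<and>
    potential m c \<le> expect (pack_traj B \<pi> pick m c) (total_rew B)"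
proof (induction m arbitrary: c)
  case 0
  have "gain i 0 a l x = 0" for i a l x by (simp add: gain_def rew_value_0)
  moreover have "queue_gain 0 (\<Sum>i\<in>active c. load i (designated c i) (local_time c i) (cur_state c i))
      (avail c) \<le> 0"
    using 0 by (intro queue_gain_0_nonpos sum_nonneg load_nonneg) (auto simp: valid_conf_def)
  ultimately show ?case by (simp add: potential_def total_rew_def)
next
  case (Suc m)
  let ?D = "designate B \<pi> pick c"
  let ?K = "\<lambda>c'. joint_kern B (cur_state c') (pack_action B c')"
  let ?P = "\<lambda>c' s'. pack_traj B \<pi> pick m (next_conf c' s')"
  have D: "finite (set_pmf ?D)" "\<And>c'. c' \<in> set_pmf ?D \<Longrightarrow> valid_conf c'"
    "\<And>c'. c' \<in> set_pmf ?D \<Longrightarrow> pending B c' = {}"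
    "potential (Suc m) c \<le> expect ?D (potential (Suc m))"
    using potential_le_designate[OF Suc.prems] by blast+
  have K: "finite (set_pmf (?K c'))" if "c' \<in> set_pmf ?D" for c'
    using D(2) that finite_set_pull by blast
  have P: "finite (set_pmf (?P c' s'))"
      "potential m (next_conf c' s') \<le> expect (?P c' s') (total_rew B)"
    if "c' \<in> set_pmf ?D" "s' \<in> set_pmf (?K c')" for c' s'
    using Suc.IH[of "next_conf c' s'"] valid_next_conf D(2) that Suc.prems(1) by auto
  have "potential (Suc m) c \<le> expect ?D (potential (Suc m))" by (rule D(4))
  also have "\<dots> \<le> expect ?D (\<lambda>c'. expect (?K c') (\<lambda>s'. expect (?P c' s')
      (\<lambda>h. joint_rew B (cur_state c') (pack_action B c') + total_rew B h)))"
  proof (intro expect_mono D(1))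
    fix c' assume c': "c' \<in> set_pmf ?D"
    have "potential (Suc m) c' = joint_rew B (cur_state c') (pack_action B c')
        + expect (?K c') (\<lambda>s'. potential m (next_conf c' s'))"
      using c' D by (intro potential_pull) auto
    also have "\<dots> \<le> joint_rew B (cur_state c') (pack_action B c')
        + expect (?K c') (\<lambda>s'. expect (?P c' s') (total_rew B))"
      using c' K P by (intro add_left_mono expect_mono) auto
    also have "\<dots> = expect (?K c') (\<lambda>s'. joint_rew B (cur_state c') (pack_action B c')
        + expect (?P c' s') (total_rew B))"
      using K[OF c'] by (simp add: expect_add)
    also have "\<dots> = expect (?K c') (\<lambda>s'. expect (?P c' s')
        (\<lambda>h. joint_rew B (cur_state c') (pack_action B c') + total_rew B h))"
      using P[OF c'] by (intro expect_cong) (simp add: expect_add)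
    finally show "potential (Suc m) c' \<le> \<dots>" .
  qed
  also have "\<dots> = expect (pack_traj B \<pi> pick (Suc m) c) (total_rew B)"
    using D(1) K P
    by (auto simp: expect_bind total_rew_def intro!: expect_cong)
  finally show ?case
    using D(1) K P by auto
qed

section \<open>The initial potential against the value of the linear program\<close>

lemma valid_init_conf:
  assumes "distinct ord" "set ord = {..<num_arms B}"
  shows "valid_conf (init_conf B ord s0)"
proof -
  have len: "length ord = num_arms B"
    using assms distinct_card[of ord] by simp
  have "set (take (max_pulls B) ord) \<inter> set (drop (max_pulls B) ord) = {}"
    using assms(1) by (simp add: set_take_disj_set_drop_if_distinct)
  moreover have "card (set (take (max_pulls B) ord)) = max_pulls B"
    using assms(1) len max_pulls_le by (simp add: distinct_card)
  ultimately show ?thesis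
    using assms(1) set_take_subset[of "max_pulls B" ord] set_drop_subset[of "max_pulls B" ord]
    unfolding assms(2)
    by (auto simp: valid_conf_def init_conf_def s0_state idle_action)
qed

text \<open>
  Arms that are active from the start earn their full expected reward, which is at least what they
  would be credited with in the queue. Treating all arms as waiting thus only lowers the bound.
\<close>

lemma queue_gain_append_le:
  "set xs \<subseteq> {..<num_arms B} \<Longrightarrow> 0 \<le> L \<Longrightarrow> queue_gain (horizon B) L (xs @ ys)
     \<le> (\<Sum>j\<leftarrow>xs. R j) + queue_gain (horizon B) (L + (\<Sum>j\<leftarrow>xs. N j)) ys"
proof (induction xs arbitrary: L)
  case (Cons j xs)
  have "R j / horizon B * (horizon B - L / max_pulls B) \<le> R j"
    using queue_head_le[of j L "horizon B"] Cons.prems by (auto simp: exp_rew_eq)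
  moreover have "0 \<le> L + N j" using Cons.prems exp_pulls_nonneg by auto
  ultimately show ?case using Cons.IH[of "L + N j"] Cons.prems by (auto simp: add_ac)
qed simp

lemma queue_gain_le_potential:
  assumes "distinct ord" "set ord = {..<num_arms B}"
  shows "queue_gain (horizon B) 0 ord \<le> potential (horizon B) (init_conf B ord s0)"
proof -
  let ?xs = "take (max_pulls B) ord" and ?ys = "drop (max_pulls B) ord"
  have xs: "set ?xs \<subseteq> {..<num_arms B}" "distinct ?xs"
    using assms set_take_subset[of "max_pulls B" ord] by auto
  have "queue_gain (horizon B) 0 (?xs @ ?ys)
      \<le> (\<Sum>j\<leftarrow>?xs. R j) + queue_gain (horizon B) (0 + (\<Sum>j\<leftarrow>?xs. N j)) ?ys"
    using xs by (intro queue_gain_append_le) auto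
  also have "(\<Sum>j\<leftarrow>?xs. R j) = (\<Sum>j\<in>set ?xs. rew_value j (horizon B) 0 (s0 j))"
    using xs by (subst sum_list_distinct_conv_sum_set) (auto intro!: sum.cong exp_rew_eq)
  also have "(\<Sum>j\<leftarrow>?xs. N j) = (\<Sum>j\<in>set ?xs. pull_value j 0 (s0 j))"
    using xs by (subst sum_list_distinct_conv_sum_set) (auto intro!: sum.cong exp_pulls_eq)
  finally show ?thesis
    by (simp add: potential_def init_conf_def gain_def load_def)
qed

text \<open>
  With \<open>M\<close> the total expected number of pulls, the load in front of an arm of \<open>xs\<close> is \<open>M\<close> minus
  the expected pulls of the arms from there on. So \<open>M\<close> times the queue gain is the sum of $R_i N_j$ over the
  pairs in which \<open>j\<close> does not precede \<open>i\<close>, where $N_j$ stands for $E[T_j]$ and $R_i$ for $E[R_i]$. For \<open>j\<close> after \<open>i\<close> this product dominates its mirror image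
  $R_j N_i$ by the order of the ratios, and therefore the sum is at least half of the one over
  all pairs.
\<close>

lemma queue_gain_ratio_order:
  assumes M: "M = real (max_pulls B) * real (horizon B)"
  shows "set xs \<subseteq> {..<num_arms B} \<Longrightarrow> (\<And>j. j \<in> set xs \<Longrightarrow> 0 < N j) \<Longrightarrow>
    sorted_wrt (\<lambda>i j. R i / N i \<ge> R j / N j) xs \<Longrightarrow>
    (\<Sum>j\<leftarrow>xs. N j) * (\<Sum>j\<leftarrow>xs. R j) \<le> 2 * (M * queue_gain (horizon B) (M - (\<Sum>j\<leftarrow>xs. N j)) xs)"
proof (induction xs)
  case (Cons j xs)
  let ?SN = "\<Sum>j\<leftarrow>xs. N j" and ?SR = "\<Sum>j\<leftarrow>xs. R j"
  have pos: "0 < max_pulls B" "0 < horizon B" using max_pulls_pos horizon_pos by auto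
  have nn: "0 \<le> R j" "0 < N j" using Cons.prems exp_rew_nonneg by auto
  have "N j * R i \<le> R j * N i" if "i \<in> set xs" for i
  proof -
    have "R i / N i \<le> R j / N j" "0 < N i" using Cons.prems that by auto
    then show ?thesis using nn by (simp add: field_simps)
  qed
  then have "(\<Sum>i\<leftarrow>xs. N j * R i) \<le> (\<Sum>i\<leftarrow>xs. R j * N i)"
    by (intro sum_list_mono) auto
  then have swap: "N j * ?SR \<le> R j * ?SN" by (simp add: sum_list_const_mult)
  have IH: "?SN * ?SR \<le> 2 * (M * queue_gain (horizon B) (M - ?SN) xs)"
    using Cons by auto
  have "M * (R j / horizon B * (horizon B - (M - (N j + ?SN)) / max_pulls B)) = R j * (N j + ?SN)"
    using pos by (simp add: M field_simps)
  then have "M * queue_gain (horizon B) (M - (N j + ?SN)) (j # xs)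
      = R j * (N j + ?SN) + M * queue_gain (horizon B) (M - ?SN) xs"
    by (simp add: distrib_left add_ac)
  moreover have "0 \<le> N j * R j" using nn by simp
  ultimately show ?case using swap IH by (simp add: algebra_simps)
qed simp

lemma pack_value_ge:
  assumes ord: "ratio_order B \<pi> s0 ord"
    and pos: "\<And>i. i < num_arms B \<Longrightarrow> 0 < N i"
    and tot: "(\<Sum>i<num_arms B. N i) = real (max_pulls B) * real (horizon B)"
  shows "1 / 2 * (\<Sum>i<num_arms B. R i) \<le> pack_value B \<pi> ord pick s0"
proof -
  have ord': "distinct ord" "set ord = {..<num_arms B}" using ord by (auto simp: ratio_order_def)
  define M where "M = real (max_pulls B) * real (horizon B)"
  have M: "0 < M" using max_pulls_pos horizon_pos by (simp add: M_def)
  have sums: "(\<Sum>j\<leftarrow>ord. N j) = M" "(\<Sum>j\<leftarrow>ord. R j) = (\<Sum>i<num_arms B. R i)"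
    using ord' tot by (auto simp: sum_list_distinct_conv_sum_set M_def)
  have "M * (\<Sum>i<num_arms B. R i) \<le> 2 * (M * queue_gain (horizon B) 0 ord)"
    using queue_gain_ratio_order[OF M_def, of ord] ord pos sums by (simp add: ratio_order_def)
  then have "(\<Sum>i<num_arms B. R i) \<le> 2 * queue_gain (horizon B) 0 ord"
    using M by (simp add: mult.left_commute[of 2])
  also have "queue_gain (horizon B) 0 ord \<le> potential (horizon B) (init_conf B ord s0)"
    using ord' by (rule queue_gain_le_potential)
  also have "\<dots> \<le> pack_value B \<pi> ord pick s0"
    unfolding pack_value_def using potential_le_pack_traj valid_init_conf[OF ord'] by blast
  finally show ?thesis by simp
qed

lemma sum_exp_rew_eq_objective:
  assumes feas: "rlp_feasible B \<pi>0 \<pi>" and \<pi>0: "\<pi>0 = return_pmf s0"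
  shows "(\<Sum>i<num_arms B. R i) = rlp_objective B \<pi>"
proof -
  have "R i = (\<Sum>t<horizon B. \<Sum>x\<in>states B i. \<Sum>a\<in>actions B i. \<pi> i x a t * rew B i x a)"
    if i: "i < num_arms B" for i
  proof -
    have "arm_rew B i h = traj_rew i h"
      if "h \<in> set_pmf (relaxed_arm_traj B \<pi> i (horizon B) 0 (s0 i))" for h
      using set_relaxed_arm_traj[OF i s0_state[OF i] _ that]
      by (simp add: arm_rew_def traj_rew_def sum_list_sum_nth case_prod_unfold atLeast0LessThan)
    then have "R i = expect (relaxed_arm_traj B \<pi> i (horizon B) 0 (s0 i)) (traj_rew i)"
      unfolding exp_rew_def expect_relaxed_traj[OF i] by (auto intro: expect_cong)
    also have "\<dots> = expect (return_pmf (s0 i))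
        (\<lambda>x. expect (relaxed_arm_traj B \<pi> i (horizon B) 0 x) (traj_rew i))" by simp
    also have "\<dots> = (\<Sum>j<horizon B. \<Sum>x\<in>states B i. \<Sum>a\<in>actions B i. \<pi> i x a (0 + j) * rew B i x a)"
    proof (intro expect_traj_rew i impI ballI)
      fix x assume x: "x \<in> states B i"
      show "pmf (return_pmf (s0 i)) x = (\<Sum>a\<in>actions B i. \<pi> i x a 0)"
        using feas i x sum_return_pmf_component[OF s0] by (simp add: rlp_feasible_def \<pi>0)
    qed (use feas i s0_state in \<open>auto simp: rlp_feasible_def\<close>)
    finally show ?thesis by simp
  qed
  then show ?thesis by (simp add: rlp_objective_def)
qed

end

theorem theorem1:
  fixes B :: "('s, 'a) bandit"
    and \<pi>0 :: "(nat \<Rightarrow> 's) pmf"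
    and s0 :: "nat \<Rightarrow> 's"
    and \<pi> :: "nat \<Rightarrow> 's \<Rightarrow> 'a \<Rightarrow> nat \<Rightarrow> real"
    and ord :: "nat list"
    and pick :: "('s, 'a) pack_conf \<Rightarrow> nat"
  assumes "is_bandit B"
    and "s0 \<in> joint_states B"
    and "pmf \<pi>0 s0 = 1"
    and "rlp_optimal B \<pi>0 \<pi>"
    and "\<And>i. i < num_arms B \<Longrightarrow> 0 < exp_pulls B \<pi> s0 i"
    and "(\<Sum>i<num_arms B. exp_pulls B \<pi> s0 i) = real (max_pulls B) * real (horizon B)"
    and "decreasing_returns B \<pi> s0"
    and "ratio_order B \<pi> s0 ord"
    and "pick_rule B pick"
  shows "measure_pmf.expectation \<pi>0 (pack_value B \<pi> ord pick)
         \<ge> 1 / 8 * measure_pmf.expectation \<pi>0 (opt_value B)"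
proof -
  have \<pi>0: "\<pi>0 = return_pmf s0" using assms(3) by (rule pmf_eq_1_imp_return)
  have feas: "rlp_feasible B \<pi>0 \<pi>" using assms(4) by (simp add: rlp_optimal_def)
  interpret packing B \<pi> s0 pick
    using assms(1,2,7,9) feas by unfold_locales (auto simp: rlp_feasible_def)
  have "opt_value B s0 \<le> (\<Sum>i<num_arms B. R i)"
    using opt_value_le_objective[OF assms(1-4)] sum_exp_rew_eq_objective[OF feas \<pi>0] by simp
  moreover have "0 \<le> (\<Sum>i<num_arms B. R i)" by (intro sum_nonneg exp_rew_nonneg) simp
  moreover have "1 / 2 * (\<Sum>i<num_arms B. R i) \<le> pack_value B \<pi> ord pick s0"
    using assms(8,5,6) by (rule pack_value_ge)
  ultimately show ?thesis by (simp add: \<pi>0)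
qed

end
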